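(* Consider the mean square asymptotically stable system $$dx(t)=[Ax(t)+Bu(t)]\,dt+\sum_{i=1}^q[N_ix(t)+M_iu(t)]\,dw_i(t),\qquad y(t)=Cx(t)+Du(t),$$ and let $Q\ge0$ be a symmetric matrix with $L(Q)+C^\top C\le0$. Let $(q_k)_{k=1,\dots,n}$ be eigenvectors of $Q$ that form an orthonormal basis of $\mathbb R^n$, with associated eigenvalues $(\mu_k)$. Let $t_0\in[0,\infty)$, let $x(t_0)$ be the value at time $t_0$ of the solution started at time $0$ in $x_0=0$ with control $u$, and let $x(t;t_0,q_k,0)$, $t\ge t_0$, be the solution of the state equation with initial time $t_0$, initial state $q_k$ and control $u\equiv0$. Then $$\mathbb E\int_{t_0}^\infty\big\|\langle x(t_0),q_k\rangle_2\,Cx(t;t_0,q_k,0)\big\|_2^2\,dt\le\mu_k\,\mathbb E\,\langle x(t_0),q_k\rangle_2^2 .$$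
   Context: Setting: $(\Omega,\mathcal F,(\mathcal F_t),\mathbb P)$ is a filtered probability space with right-continuous and complete filtration; $w=(w_1,\dots,w_q)^\top$ is an $\mathbb R^q$-valued $(\mathcal F_t)$-adapted Wiener process (here on $[0,\infty)$) whose increments $w(t+h)-w(t)$ are independent of $\mathcal F_t$, with covariance matrix $K=(k_{ij})_{i,j=1,\dots,q}$, i.e. $\mathbb E[w(t)w(t)^\top]=Kt$. The coefficients are $A,N_i\in\mathbb R^{n\times n}$, $B,M_i\in\mathbb R^{n\times m}$, $C\in\mathbb R^{p\times n}$, $D\in\mathbb R^{p\times m}$. The control $u$ is $\mathbb R^m$-valued, $(\mathcal F_t)$-adapted, with $\mathbb E\int_0^T\|u(t)\|_2^2dt<\infty$ for every $T>0$. $\langle\cdot,\cdot\rangle_2$, $\|\cdot\|_2$ are the Euclidean inner product and norm. Mean square asymptotic stability means: for $u\equiv0$ and any initial state $x_0\in\mathbb R^n$, $\mathbb E\|x(t)\|_2^2\to0$ as $t\to\infty$. For symmetric matrices, $M_1\ge M_2$ means $M_1-M_2$ is positive semidefinite. Operator: $L(X)=A^\top X+XA+\sum_{i,j=1}^qN_i^\top XN_jk_{ij}$. *)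

theory Defs
  imports "HOL-Probability.Probability"
begin

section \<open>Symmetric matrices and the generalised Lyapunov operator\<close>

definition psd :: "real^'n^'n \<Rightarrow> bool"
  where "psd X \<longleftrightarrow> transpose X = X \<and> (\<forall>v. 0 \<le> v \<bullet> (X *v v))"

definition loewner_le :: "real^'n^'n \<Rightarrow> real^'n^'n \<Rightarrow> bool"
  where "loewner_le X Y \<longleftrightarrow> psd (Y - X)"

definition lyapunov_op ::
    "real^'n^'n \<Rightarrow> ('q::finite \<Rightarrow> real^'n^'n) \<Rightarrow> real^'q^'q \<Rightarrow> real^'n^'n \<Rightarrow> real^'n^'n"
  where "lyapunov_op A N K X =
    transpose A ** X + X ** A
    + (\<Sum>i\<in>UNIV. \<Sum>j\<in>UNIV. (K $ i $ j) *\<^sub>R (transpose (N i) ** X ** N j))"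

definition orthonormal_basis :: "('n \<Rightarrow> real^'n) \<Rightarrow> bool"
  where "orthonormal_basis q \<longleftrightarrow>
    (\<forall>j k. q j \<bullet> q k = (if j = k then 1 else 0)) \<and> span (range q) = UNIV"


section \<open>Filtered probability spaces and Wiener processes\<close>

text \<open>Time is \<open>[0,\<infinity>)\<close>. Processes and filtrations are indexed by \<open>real\<close> and their values at
  negative times are irrelevant; this is the purpose of \<open>max 0 t\<close> below.\<close>

definition usual_filtered_prob_space :: "'w measure \<Rightarrow> (real \<Rightarrow> 'w measure) \<Rightarrow> bool"
  where "usual_filtered_prob_space P F \<longleftrightarrow>
    prob_space P \<and>
    filtration (space P) (\<lambda>t. F (max 0 t)) \<and>
    (\<forall>t\<ge>0. sets (F t) \<subseteq> sets P) \<and>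
    (\<forall>t\<ge>0. sets (F t) = (\<Inter>s\<in>{t<..}. sets (F s))) \<and>
    (\<forall>Z\<in>null_sets P. \<forall>S\<subseteq>Z. S \<in> sets (F 0))"

definition centered_normal :: "real \<Rightarrow> real measure"
  where "centered_normal v =
    (if v = 0 then return borel 0 else density lborel (\<lambda>y. ennreal (normal_density 0 (sqrt v) y)))"

text \<open>\<open>K\<close> may be singular, so an increment is Gaussian in the sense that all its linear functionals
  are (possibly degenerate) normal variables.\<close>

definition wiener_process ::
    "'w measure \<Rightarrow> (real \<Rightarrow> 'w measure) \<Rightarrow> real^'q^'q \<Rightarrow> (real \<Rightarrow> 'w \<Rightarrow> real^'q) \<Rightarrow> bool"
  where "wiener_process P F K w \<longleftrightarrow>
    (AE \<omega> in P. w 0 \<omega> = 0) \<and>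
    (AE \<omega> in P. continuous_on {0..} (\<lambda>t. w t \<omega>)) \<and>
    (\<forall>t\<ge>0. w t \<in> borel_measurable (F t)) \<and>
    (\<forall>t\<ge>0. \<forall>h\<ge>0. prob_space.indep_set P (sets (F t))
        (sets (vimage_algebra (space P) (\<lambda>\<omega>. w (t + h) \<omega> - w t \<omega>) borel))) \<and>
    (\<forall>t\<ge>0. \<forall>h\<ge>0. \<forall>v. distr P borel (\<lambda>\<omega>. v \<bullet> (w (t + h) \<omega> - w t \<omega>))
        = centered_normal (h * (v \<bullet> (K *v v)))) \<and>
    (\<forall>t\<ge>0. \<forall>i j. (LINT \<omega>|P. w t \<omega> $ i * w t \<omega> $ j) = K $ i $ j * t)"

definition adapted_measurable ::
    "'w measure \<Rightarrow> (real \<Rightarrow> 'w measure) \<Rightarrow> real set \<Rightarrow> (real \<Rightarrow> 'w \<Rightarrow> 'b::euclidean_space) \<Rightarrow> bool"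
  where "adapted_measurable P F J X \<longleftrightarrow>
    (\<forall>t\<in>J. X t \<in> borel_measurable (F t)) \<and>
    (\<lambda>(t, \<omega>). X t \<omega>) \<in> borel_measurable (restrict_space borel J \<Otimes>\<^sub>M P)"

definition L2_adapted ::
    "'w measure \<Rightarrow> (real \<Rightarrow> 'w measure) \<Rightarrow> real \<Rightarrow> (real \<Rightarrow> 'w \<Rightarrow> 'b::euclidean_space) \<Rightarrow> bool"
  where "L2_adapted P F s X \<longleftrightarrow>
    adapted_measurable P F {s..} X \<and>
    (\<forall>T>s. (\<integral>\<^sup>+\<omega>. (\<integral>\<^sup>+t\<in>{s..T}. ennreal ((norm (X t \<omega>))\<^sup>2) \<partial>lborel) \<partial>P) < \<infinity>)"


section \<open>The Ito integral\<close>

text \<open>A simple process on \<open>[s,t]\<close> is given by a partition \<open>s = \<tau> 0 \<le> \<dots> \<le> \<tau> m = t\<close> and bounded,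
  \<open>F (\<tau> j)\<close>-measurable variables \<open>\<xi> j\<close> for \<open>j < m\<close>; its value on \<open>(\<tau> j, \<tau> (j+1)]\<close> is \<open>\<xi> j\<close>.\<close>

definition simple_process ::
    "'w measure \<Rightarrow> (real \<Rightarrow> 'w measure) \<Rightarrow> real \<Rightarrow> real \<Rightarrow> nat \<Rightarrow> (nat \<Rightarrow> real)
      \<Rightarrow> (nat \<Rightarrow> 'w \<Rightarrow> 'b::euclidean_space) \<Rightarrow> bool"
  where "simple_process P F s t m \<tau> \<xi> \<longleftrightarrow>
    \<tau> 0 = s \<and> \<tau> m = t \<and> (\<forall>j<m. \<tau> j \<le> \<tau> (Suc j)) \<and>
    (\<forall>j<m. \<xi> j \<in> borel_measurable (F (\<tau> j)) \<and> (\<exists>c. \<forall>\<omega>\<in>space P. norm (\<xi> j \<omega>) \<le> c))"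

definition simple_value ::
    "nat \<Rightarrow> (nat \<Rightarrow> real) \<Rightarrow> (nat \<Rightarrow> 'w \<Rightarrow> 'b::euclidean_space) \<Rightarrow> real \<Rightarrow> 'w \<Rightarrow> 'b"
  where "simple_value m \<tau> \<xi> r \<omega> = (\<Sum>j<m. indicator {\<tau> j<..\<tau> (Suc j)} r *\<^sub>R \<xi> j \<omega>)"

definition simple_integral_wrt ::
    "(real \<Rightarrow> 'w \<Rightarrow> real) \<Rightarrow> nat \<Rightarrow> (nat \<Rightarrow> real) \<Rightarrow> (nat \<Rightarrow> 'w \<Rightarrow> 'b::euclidean_space) \<Rightarrow> 'w \<Rightarrow> 'b"
  where "simple_integral_wrt W m \<tau> \<xi> \<omega> = (\<Sum>j<m. (W (\<tau> (Suc j)) \<omega> - W (\<tau> j) \<omega>) *\<^sub>R \<xi> j \<omega>)"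

text \<open>\<open>has_ito_integral P F W s t f I\<close>: the random variable \<open>I\<close> is a version of \<open>\<integral>\<^sub>s\<^sup>t f dW\<close>, i.e. the
  \<open>L\<^sup>2\<close>-limit of the integrals of simple processes that converge to \<open>f\<close> in \<open>L\<^sup>2([s,t] \<times> \<Omega>)\<close>.\<close>

definition has_ito_integral ::
    "'w measure \<Rightarrow> (real \<Rightarrow> 'w measure) \<Rightarrow> (real \<Rightarrow> 'w \<Rightarrow> real) \<Rightarrow> real \<Rightarrow> real
      \<Rightarrow> (real \<Rightarrow> 'w \<Rightarrow> 'b::euclidean_space) \<Rightarrow> ('w \<Rightarrow> 'b) \<Rightarrow> bool"
  where "has_ito_integral P F W s t f I \<longleftrightarrow>
    adapted_measurable P F {s..t} f \<and> I \<in> borel_measurable P \<and>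
    (\<exists>m \<tau> \<xi>.
      (\<forall>k::nat. simple_process P F s t (m k) (\<tau> k) (\<xi> k)) \<and>
      (\<lambda>k. \<integral>\<^sup>+\<omega>. (\<integral>\<^sup>+r\<in>{s..t}.
          ennreal ((norm (f r \<omega> - simple_value (m k) (\<tau> k) (\<xi> k) r \<omega>))\<^sup>2) \<partial>lborel) \<partial>P)
        \<longlonglongrightarrow> 0 \<and>
      (\<lambda>k. \<integral>\<^sup>+\<omega>. ennreal ((norm (simple_integral_wrt W (m k) (\<tau> k) (\<xi> k) \<omega> - I \<omega>))\<^sup>2) \<partial>P)
        \<longlonglongrightarrow> 0)"


section \<open>Linear stochastic systems\<close>

text \<open>\<open>x\<close> solves \<open>dx = (A x + B u) dt + \<Sum>\<^sub>i (N\<^sub>i x + M\<^sub>i u) dw\<^sub>i\<close> on \<open>[t0,\<infinity>)\<close> with \<open>x(t0) = x0\<close>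
  (the initial condition is the integral equation at \<open>t = t0\<close>).\<close>

definition sde_solution ::
    "'w measure \<Rightarrow> (real \<Rightarrow> 'w measure) \<Rightarrow> (real \<Rightarrow> 'w \<Rightarrow> real^'q)
      \<Rightarrow> real^'n^'n \<Rightarrow> real^'m^'n \<Rightarrow> ('q::finite \<Rightarrow> real^'n^'n) \<Rightarrow> ('q \<Rightarrow> real^'m^'n)
      \<Rightarrow> (real \<Rightarrow> 'w \<Rightarrow> real^'m) \<Rightarrow> real \<Rightarrow> real^'n \<Rightarrow> (real \<Rightarrow> 'w \<Rightarrow> real^'n) \<Rightarrow> bool"
  where "sde_solution P F w A B N M u t0 x0 x \<longleftrightarrow>
    L2_adapted P F t0 x \<and>
    (AE \<omega> in P. continuous_on {t0..} (\<lambda>t. x t \<omega>)) \<and>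
    (\<forall>t\<ge>t0. \<exists>I.
      (\<forall>i. has_ito_integral P F (\<lambda>r \<omega>. w r \<omega> $ i) t0 t
             (\<lambda>r \<omega>. N i *v x r \<omega> + M i *v u r \<omega>) (I i)) \<and>
      (AE \<omega> in P. x t \<omega> =
         x0 + (LINT r:{t0..t}|lborel. A *v x r \<omega> + B *v u r \<omega>) + (\<Sum>i\<in>UNIV. I i \<omega>)))"

definition mean_square_asymptotically_stable ::
    "'w measure \<Rightarrow> (real \<Rightarrow> 'w measure) \<Rightarrow> (real \<Rightarrow> 'w \<Rightarrow> real^'q)
      \<Rightarrow> real^'n^'n \<Rightarrow> real^'m^'n \<Rightarrow> ('q::finite \<Rightarrow> real^'n^'n) \<Rightarrow> ('q \<Rightarrow> real^'m^'n) \<Rightarrow> bool"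
  where "mean_square_asymptotically_stable P F w A B N M \<longleftrightarrow>
    (\<forall>x0 x. sde_solution P F w A B N M (\<lambda>_ _. 0) 0 x0 x \<longrightarrow>
      ((\<lambda>t. \<integral>\<^sup>+\<omega>. ennreal ((norm (x t \<omega>))\<^sup>2) \<partial>P) \<longlongrightarrow> 0) at_top)"

end

theory Submission
  imports Defs
begin

text \<open>
  Put \<open>\<xi> = \<langle>x(t0), q\<^sub>k\<rangle>\<close>. This variable is \<open>F t0\<close>-measurable, so for a bounded truncation \<open>\<eta>\<close> of \<open>\<xi>\<close> the
  process \<open>v = \<eta> z\<close> solves the uncontrolled equation from time \<open>t0\<close> with the random initial state
  \<open>\<eta> q\<^sub>k\<close>, because the factor \<open>\<eta>\<close> may be moved into Ito integrals that start at \<open>t0\<close>. For \<open>T \<ge> t0\<close>,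

    \<open>E \<langle>v(T), Q v(T)\<rangle> = E \<langle>\<eta> q\<^sub>k, Q \<eta> q\<^sub>k\<rangle> + E \<integral> \<langle>v, L(Q) v\<rangle>\<close>, with the integral over \<open>[t0, T]\<close>.

  The left side is nonnegative because \<open>Q \<ge> 0\<close>, the integrand is at most \<open>- \<bar>C v\<bar>\<^sup>2\<close> because
  \<open>L(Q) + C\<^sup>T C \<le> 0\<close>, and the first term on the right is \<open>\<mu>\<^sub>k E \<eta>\<^sup>2\<close> because \<open>Q q\<^sub>k = \<mu>\<^sub>k q\<^sub>k\<close>. Hence
  \<open>E \<integral> \<bar>C v\<bar>\<^sup>2 \<le> \<mu>\<^sub>k E \<eta>\<^sup>2\<close> on \<open>[t0, T]\<close> (lemma \<open>weighted_output_energy_le\<close>), and Fatou's lemma removes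
  the truncation and the finite horizon at the same time.

  The displayed identity (lemma \<open>expectation_quadratic_form\<close>) is the mean of Ito's formula for a
  quadratic form; it can be had without the formula. Write \<open>v = y + M\<close> with
  \<open>y = \<eta> q\<^sub>k + \<integral> A v\<close>, whose paths are continuously differentiable, and \<open>M\<close> the sum of the Ito
  integrals. In \<open>\<langle>v, Q v\<rangle> = \<langle>y, Q y\<rangle> + 2 \<langle>y, Q M\<rangle> + \<langle>M, Q M\<rangle>\<close> the first term is treated by the
  fundamental theorem of calculus path by path, the last one by the Ito isometry. For the mixed term,
  \<open>E \<langle>\<integral> A v(r) dr, Q M(T)\<rangle> = \<integral> E \<langle>A v(r), Q M(r)\<rangle> dr\<close>, since increments of \<open>M\<close> after time \<open>r\<close> are
  orthogonal to everything known at time \<open>r\<close>. As \<open>M(r) = v(r) - y(r)\<close>, the terms containing \<open>y\<close> cancel.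

  Both facts about Ito integrals, the isometry (\<open>ito_isometry\<close>) and the orthogonality to the past
  (\<open>expectation_past_inner_ito\<close>), are proved for finite sums of terms \<open>1\<^bsub>(a,b]\<^esub> \<xi>\<close> and carried over to
  limits in \<open>L\<^sup>2\<close>. For such sums the orthogonality holds because increments of the Wiener process are
  centred and independent of the past, and the isometry because two increments, multiplied by a bounded
  factor that is known when the later one starts, have the expected product \<open>K\<^sub>i\<^sub>j\<close> times the length of
  the overlap times the mean of the factor.
\<close>

section \<open>Square-integrable functions\<close>

definition square_integrable :: "'a measure \<Rightarrow> ('a \<Rightarrow> 'b::euclidean_space) \<Rightarrow> bool"
  where "square_integrable M f \<longleftrightarrow>
    f \<in> borel_measurable M \<and> integrable M (\<lambda>x. (norm (f x))\<^sup>2)"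

definition l2_tendsto ::
    "'a measure \<Rightarrow> (nat \<Rightarrow> 'a \<Rightarrow> 'b::euclidean_space) \<Rightarrow> ('a \<Rightarrow> 'b) \<Rightarrow> bool"
  where "l2_tendsto M X f \<longleftrightarrow>
    (\<forall>n. square_integrable M (X n)) \<and> square_integrable M f \<and>
    (\<lambda>n. LINT x|M. (norm (X n x - f x))\<^sup>2) \<longlonglongrightarrow> 0"

lemma null_sequence_of_le:
  fixes a b :: "nat \<Rightarrow> real"
  assumes "\<And>n. 0 \<le> a n" "\<And>n. a n \<le> b n" "b \<longlonglongrightarrow> 0"
  shows "a \<longlonglongrightarrow> 0"
  by (rule tendsto_sandwich[OF _ _ tendsto_const assms(3)]) (use assms in auto)

lemma square_integrable_measurable:
  "square_integrable M f \<Longrightarrow> f \<in> borel_measurable M"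
  by (simp add: square_integrable_def)

lemma square_integrable_norm:
  "square_integrable M f \<Longrightarrow> integrable M (\<lambda>x. (norm (f x))\<^sup>2)"
  by (simp add: square_integrable_def)

lemma square_integrable_bound:
  fixes f :: "'a \<Rightarrow> 'b::euclidean_space" and h :: "'a \<Rightarrow> real"
  assumes f: "f \<in> borel_measurable M" and h: "integrable M h"
    and le: "AE x in M. (norm (f x))\<^sup>2 \<le> h x"
  shows "square_integrable M f"
proof -
  have "integrable M (\<lambda>x. (norm (f x))\<^sup>2)"
    by (rule Bochner_Integration.integrable_bound[OF h]) (use f le in auto)
  with f show ?thesis by (simp add: square_integrable_def)
qed

lemma norm_add_square_le:
  fixes a b :: "'b::real_inner"
  shows "(norm (a + b))\<^sup>2 \<le> 2 * (norm a)\<^sup>2 + 2 * (norm b)\<^sup>2"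
proof -
  have "(norm (a + b))\<^sup>2 + (norm (a - b))\<^sup>2 = 2 * (norm a)\<^sup>2 + 2 * (norm b)\<^sup>2"
    by (simp add: power2_norm_eq_inner algebra_simps inner_commute)
  then show ?thesis by (smt (verit) zero_le_power2)
qed

lemma abs_inner_le_squares:
  fixes a b :: "'b::real_inner"
  shows "\<bar>a \<bullet> b\<bar> \<le> (norm a)\<^sup>2 + (norm b)\<^sup>2"
proof -
  have "\<bar>a \<bullet> b\<bar> \<le> norm a * norm b" by (rule Cauchy_Schwarz_ineq2)
  moreover have "2 * (norm a * norm b) \<le> (norm a)\<^sup>2 + (norm b)\<^sup>2"
    using sum_squares_bound[of "norm a" "norm b"] by simp
  moreover have "0 \<le> norm a * norm b" by simp
  ultimately show ?thesis by linarith
qed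

lemma square_integrable_add:
  assumes "square_integrable M f" "square_integrable M g"
  shows "square_integrable M (\<lambda>x. f x + g x)"
  using assms
  by (intro square_integrable_bound[where h = "\<lambda>x. 2 * (norm (f x))\<^sup>2 + 2 * (norm (g x))\<^sup>2"])
     (auto simp: square_integrable_def norm_add_square_le)

lemma square_integrable_uminus:
  "square_integrable M f \<Longrightarrow> square_integrable M (\<lambda>x. - f x)"
  by (simp add: square_integrable_def)

lemma square_integrable_diff:
  assumes "square_integrable M f" "square_integrable M g"
  shows "square_integrable M (\<lambda>x. f x - g x)"
  using square_integrable_add[OF assms(1) square_integrable_uminus[OF assms(2)]] by simp

lemma square_integrable_zero: "square_integrable M (\<lambda>x. 0)"
  by (simp add: square_integrable_def)

lemma square_integrable_sum:
  "(\<And>i. i \<in> I \<Longrightarrow> square_integrable M (f i)) \<Longrightarrow> square_integrable M (\<lambda>x. \<Sum>i\<in>I. f i x)"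
  by (induction I rule: infinite_finite_induct)
     (auto intro: square_integrable_add square_integrable_zero)

lemma square_integrable_linear:
  assumes f: "square_integrable M f" and T: "bounded_linear T"
  shows "square_integrable M (\<lambda>x. T (f x))"
proof -
  interpret bounded_linear T by (rule T)
  obtain k where k: "0 < k" "\<And>x. norm (T x) \<le> norm x * k" using pos_bounded by blast
  have "(norm (T (f x)))\<^sup>2 \<le> (norm (f x))\<^sup>2 * k\<^sup>2" for x
    using power_mono[OF k(2)[of "f x"], of 2] by (simp add: power_mult_distrib)
  then show ?thesis
    using f borel_measurable_continuous_on[OF linear_continuous_on[OF T], of f M]
    by (intro square_integrable_bound[where h = "\<lambda>x. (norm (f x))\<^sup>2 * k\<^sup>2"])
       (simp_all add: square_integrable_def)
qed

lemma square_integrable_scaleR_bounded: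
  assumes f: "square_integrable M f" and \<eta>: "\<eta> \<in> borel_measurable M"
    and c: "\<And>x. x \<in> space M \<Longrightarrow> \<bar>\<eta> x\<bar> \<le> c"
  shows "square_integrable M (\<lambda>x. \<eta> x *\<^sub>R f x)"
proof -
  have "(norm (\<eta> x *\<^sub>R f x))\<^sup>2 \<le> c\<^sup>2 * (norm (f x))\<^sup>2" if "x \<in> space M" for x
    using power_mono[OF c[OF that], of 2]
    by (auto simp: power_mult_distrib intro!: mult_right_mono)
  then show ?thesis
    using f \<eta>
    by (intro square_integrable_bound[where h = "\<lambda>x. c\<^sup>2 * (norm (f x))\<^sup>2"])
       (auto simp: square_integrable_def)
qed

lemma (in finite_measure) square_integrable_bounded:
  assumes f: "f \<in> borel_measurable M" and c: "\<And>x. x \<in> space M \<Longrightarrow> norm (f x) \<le> c"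
  shows "square_integrable M f"
  by (rule square_integrable_bound[where h = "\<lambda>x. c\<^sup>2"])
     (use f c in \<open>auto intro!: power_mono\<close>)

lemma square_integrable_cong_AE:
  assumes "square_integrable M f" "g \<in> borel_measurable M" "AE x in M. f x = g x"
  shows "square_integrable M g"
  by (rule square_integrable_bound[OF assms(2) square_integrable_norm[OF assms(1)]])
     (use assms(3) in auto)

lemma integrable_inner:
  assumes "square_integrable M f" "square_integrable M g"
  shows "integrable M (\<lambda>x. f x \<bullet> g x)"
proof (rule Bochner_Integration.integrable_bound)
  show "integrable M (\<lambda>x. (norm (f x))\<^sup>2 + (norm (g x))\<^sup>2)"
    using assms by (simp add: square_integrable_def)
  show "(\<lambda>x. f x \<bullet> g x) \<in> borel_measurable M"
    using assms by (auto simp: square_integrable_def intro: borel_measurable_inner)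
  have "norm (f x \<bullet> g x) \<le> norm ((norm (f x))\<^sup>2 + (norm (g x))\<^sup>2)" for x
    using abs_inner_le_squares[of "f x" "g x"] unfolding real_norm_def by linarith
  then show "AE x in M. norm (f x \<bullet> g x) \<le> norm ((norm (f x))\<^sup>2 + (norm (g x))\<^sup>2)"
    by simp
qed

text \<open>The discriminant argument: the quadratic polynomial \<open>\<integral>\<bar>f - s g\<bar>\<^sup>2\<close> in \<open>s\<close> is nonnegative.\<close>

lemma integral_Cauchy_Schwarz:
  assumes f: "square_integrable M f" and g: "square_integrable M g"
  shows "\<bar>LINT x|M. f x \<bullet> g x\<bar> \<le>
    sqrt (LINT x|M. (norm (f x))\<^sup>2) * sqrt (LINT x|M. (norm (g x))\<^sup>2)"
proof -
  let ?a = "LINT x|M. (norm (f x))\<^sup>2" and ?b = "LINT x|M. (norm (g x))\<^sup>2"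
    and ?c = "LINT x|M. f x \<bullet> g x"
  have nonneg: "0 \<le> ?a - 2 * s * ?c + s\<^sup>2 * ?b" for s
  proof -
    have "0 \<le> (LINT x|M. (norm (f x - s *\<^sub>R g x))\<^sup>2)" by simp
    also have "\<dots> = (LINT x|M. (norm (f x))\<^sup>2 - 2 * s * (f x \<bullet> g x) + s\<^sup>2 * (norm (g x))\<^sup>2)"
      by (intro Bochner_Integration.integral_cong)
         (auto simp: power2_norm_eq_inner algebra_simps inner_commute power2_eq_square[of s])
    also have "\<dots> = ?a - 2 * s * ?c + s\<^sup>2 * ?b"
      using f g integrable_inner[OF f g] by (simp add: square_integrable_def)
    finally show ?thesis .
  qed
  have b0: "0 \<le> ?b" by simp
  have "?c\<^sup>2 \<le> ?a * ?b"
  proof (cases "?b = 0")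
    case True
    have "?c = 0"
    proof (rule ccontr)
      assume "?c \<noteq> 0"
      with nonneg[of "(?a + 1) / (2 * ?c)"] True show False by simp
    qed
    then show ?thesis by simp
  next
    case False
    with b0 have "0 < ?b" by linarith
    with nonneg[of "?c / ?b"] show ?thesis
      by (simp add: field_simps power2_eq_square)
  qed
  then have "sqrt (?c\<^sup>2) \<le> sqrt (?a * ?b)" by (rule real_sqrt_le_mono)
  then show ?thesis by (simp add: real_sqrt_mult)
qed

lemma l2_tendsto_inner:
  assumes X: "l2_tendsto M X f" and Y: "l2_tendsto M Y g"
  shows "(\<lambda>n. LINT x|M. X n x \<bullet> Y n x) \<longlonglongrightarrow> (LINT x|M. f x \<bullet> g x)"
proof -
  note si = X[unfolded l2_tendsto_def] Y[unfolded l2_tendsto_def]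
  let ?e = "\<lambda>n. sqrt (LINT x|M. (norm (X n x - f x))\<^sup>2)"
    and ?d = "\<lambda>n. sqrt (LINT x|M. (norm (Y n x - g x))\<^sup>2)"
    and ?a = "sqrt (LINT x|M. (norm (f x))\<^sup>2)" and ?b = "sqrt (LINT x|M. (norm (g x))\<^sup>2)"
  have e: "?e \<longlonglongrightarrow> 0" and d: "?d \<longlonglongrightarrow> 0"
    using si tendsto_real_sqrt[of "\<lambda>n. LINT x|M. (norm (X n x - f x))\<^sup>2" 0]
      tendsto_real_sqrt[of "\<lambda>n. LINT x|M. (norm (Y n x - g x))\<^sup>2" 0] by simp_all
  have bd: "norm ((LINT x|M. X n x \<bullet> Y n x) - (LINT x|M. f x \<bullet> g x))
      \<le> ?e n * ?d n + ?e n * ?b + ?a * ?d n" for n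
  proof -
    have sX: "square_integrable M (\<lambda>x. X n x - f x)" and sY: "square_integrable M (\<lambda>x. Y n x - g x)"
      and sf: "square_integrable M f" and sg: "square_integrable M g"
      using si square_integrable_diff by blast+
    have XY: "X n x \<bullet> Y n x =
        (X n x - f x) \<bullet> (Y n x - g x) + (X n x - f x) \<bullet> g x + f x \<bullet> (Y n x - g x) + f x \<bullet> g x" for x
      by (simp add: algebra_simps)
    have "(LINT x|M. X n x \<bullet> Y n x) - (LINT x|M. f x \<bullet> g x) =
        (LINT x|M. (X n x - f x) \<bullet> (Y n x - g x)) + (LINT x|M. (X n x - f x) \<bullet> g x)
        + (LINT x|M. f x \<bullet> (Y n x - g x))"
      unfolding XY
      using integrable_inner[OF sX sY] integrable_inner[OF sX sg] integrable_inner[OF sf sY]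
        integrable_inner[OF sf sg]
      by simp
    then show ?thesis
      using integral_Cauchy_Schwarz[OF sX sY] integral_Cauchy_Schwarz[OF sX sg]
        integral_Cauchy_Schwarz[OF sf sY]
      unfolding real_norm_def by linarith
  qed
  have "(\<lambda>n. ?e n * ?d n + ?e n * ?b + ?a * ?d n) \<longlonglongrightarrow> 0 * 0 + 0 * ?b + ?a * 0"
    by (intro tendsto_intros e d)
  then have "(\<lambda>n. (LINT x|M. X n x \<bullet> Y n x) - (LINT x|M. f x \<bullet> g x)) \<longlonglongrightarrow> 0"
    by (intro Lim_null_comparison[OF always_eventually[OF allI[OF bd]]]) simp
  then show ?thesis by (simp add: LIM_zero_iff)
qed

text \<open>Linear images, products with bounded functions and truncations all converge for this reason.\<close>

lemma l2_tendsto_dominated: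
  assumes X: "l2_tendsto M X f"
    and Y: "\<And>n. square_integrable M (Y n)" and g: "square_integrable M g"
    and le: "\<And>n. AE x in M. (norm (Y n x - g x))\<^sup>2 \<le> c * (norm (X n x - f x))\<^sup>2"
  shows "l2_tendsto M Y g"
proof -
  have sX: "square_integrable M (X n)" and f: "square_integrable M f"
    and lim: "(\<lambda>n. LINT x|M. (norm (X n x - f x))\<^sup>2) \<longlonglongrightarrow> 0" for n
    using X unfolding l2_tendsto_def by blast+
  have le_int: "(LINT x|M. (norm (Y n x - g x))\<^sup>2) \<le> c * (LINT x|M. (norm (X n x - f x))\<^sup>2)" for n
  proof -
    have "(LINT x|M. (norm (Y n x - g x))\<^sup>2) \<le> (LINT x|M. c * (norm (X n x - f x))\<^sup>2)"
      by (intro integral_mono_AE le integrable_mult_right square_integrable_norm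
          square_integrable_diff sX f Y g)
    then show ?thesis by simp
  qed
  have "(\<lambda>n. c * (LINT x|M. (norm (X n x - f x))\<^sup>2)) \<longlonglongrightarrow> c * 0"
    by (intro tendsto_intros lim)
  then have "(\<lambda>n. LINT x|M. (norm (Y n x - g x))\<^sup>2) \<longlonglongrightarrow> 0"
    by (simp add: null_sequence_of_le[where b = "\<lambda>n. c * (LINT x|M. (norm (X n x - f x))\<^sup>2)", OF _ le_int])
  with Y g show ?thesis by (simp add: l2_tendsto_def)
qed

lemma l2_tendsto_linear:
  assumes X: "l2_tendsto M X f" and T: "bounded_linear T"
  shows "l2_tendsto M (\<lambda>n x. T (X n x)) (\<lambda>x. T (f x))"
proof -
  interpret bounded_linear T by (rule T)
  obtain k where k: "0 < k" "\<And>x. norm (T x) \<le> norm x * k" using pos_bounded by blast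
  have "(norm (T (X n x) - T (f x)))\<^sup>2 \<le> k\<^sup>2 * (norm (X n x - f x))\<^sup>2" for n x
    using power_mono[OF k(2)[of "X n x - f x"], of 2]
    by (simp add: power_mult_distrib diff mult.commute)
  then show ?thesis
    using X by (intro l2_tendsto_dominated[OF X, where c = "k\<^sup>2"])
      (simp_all add: l2_tendsto_def square_integrable_linear[OF _ T])
qed

lemma l2_tendsto_scaleR_bounded:
  assumes X: "l2_tendsto M X f" and \<eta>: "\<eta> \<in> borel_measurable M"
    and c: "\<And>x. x \<in> space M \<Longrightarrow> \<bar>\<eta> x\<bar> \<le> c"
  shows "l2_tendsto M (\<lambda>n x. \<eta> x *\<^sub>R X n x) (\<lambda>x. \<eta> x *\<^sub>R f x)"
proof -
  have "(norm (\<eta> x *\<^sub>R X n x - \<eta> x *\<^sub>R f x))\<^sup>2 \<le> c\<^sup>2 * (norm (X n x - f x))\<^sup>2"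
    if "x \<in> space M" for n x
    using power_mono[OF c[OF that], of 2]
    by (auto simp: power_mult_distrib scaleR_diff_right[symmetric] intro!: mult_right_mono)
  then show ?thesis
    using X by (intro l2_tendsto_dominated[OF X, where c = "c\<^sup>2"])
      (simp_all add: l2_tendsto_def square_integrable_scaleR_bounded[OF _ \<eta> c])
qed

lemma l2_tendsto_add:
  assumes X: "l2_tendsto M X f" and Y: "l2_tendsto M Y g"
  shows "l2_tendsto M (\<lambda>n x. X n x + Y n x) (\<lambda>x. f x + g x)"
proof -
  note si = X[unfolded l2_tendsto_def] Y[unfolded l2_tendsto_def]
  have sX: "square_integrable M (\<lambda>x. X n x - f x)" and sY: "square_integrable M (\<lambda>x. Y n x - g x)" for n
    using si square_integrable_diff by blast+
  have sXY: "square_integrable M (\<lambda>x. X n x + Y n x)" "square_integrable M (\<lambda>x. f x + g x)" for n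
    using si square_integrable_add by blast+
  have le: "(LINT x|M. (norm (X n x + Y n x - (f x + g x)))\<^sup>2) \<le>
      2 * (LINT x|M. (norm (X n x - f x))\<^sup>2) + 2 * (LINT x|M. (norm (Y n x - g x))\<^sup>2)" (is "?l n \<le> ?r n") for n
  proof -
    have "?l n \<le> (LINT x|M. 2 * (norm (X n x - f x))\<^sup>2 + 2 * (norm (Y n x - g x))\<^sup>2)"
    proof (rule integral_mono)
      show "integrable M (\<lambda>x. (norm (X n x + Y n x - (f x + g x)))\<^sup>2)"
        by (rule square_integrable_norm[OF square_integrable_diff[OF sXY]])
      show "integrable M (\<lambda>x. 2 * (norm (X n x - f x))\<^sup>2 + 2 * (norm (Y n x - g x))\<^sup>2)"
        using sX sY by (simp add: square_integrable_def)
      show "(norm (X n x + Y n x - (f x + g x)))\<^sup>2 \<le>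
          2 * (norm (X n x - f x))\<^sup>2 + 2 * (norm (Y n x - g x))\<^sup>2" for x
        using norm_add_square_le[of "X n x - f x" "Y n x - g x"] by (simp add: algebra_simps)
    qed
    also have "\<dots> = ?r n" using sX[of n] sY[of n] by (simp add: square_integrable_def)
    finally show ?thesis .
  qed
  have "?r \<longlonglongrightarrow> 2 * 0 + 2 * 0" by (intro tendsto_intros) (use si in auto)
  then have "?l \<longlonglongrightarrow> 0"
    by (simp add: null_sequence_of_le[where b = ?r, OF _ le])
  with sXY show ?thesis by (simp add: l2_tendsto_def)
qed

lemma l2_tendsto_const: "square_integrable M f \<Longrightarrow> l2_tendsto M (\<lambda>n. f) f"
  by (simp add: l2_tendsto_def)

text \<open>Early members of a sequence that converges in the sense of extended nonnegative integrals may
  be at infinite distance from the limit, hence the shift by \<open>d\<close>.\<close>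

lemma l2_tendsto_of_nn_integral:
  fixes X :: "nat \<Rightarrow> 'a \<Rightarrow> 'b::euclidean_space"
  assumes X: "\<And>n. square_integrable M (X n)" and f: "f \<in> borel_measurable M"
    and lim: "(\<lambda>n. \<integral>\<^sup>+x. ennreal ((norm (X n x - f x))\<^sup>2) \<partial>M) \<longlonglongrightarrow> 0"
  shows "\<exists>d0. \<forall>d\<ge>d0. l2_tendsto M (\<lambda>n. X (n + d)) f"
proof -
  have "\<forall>\<^sub>F n in sequentially. (\<integral>\<^sup>+x. ennreal ((norm (X n x - f x))\<^sup>2) \<partial>M) < \<infinity>"
    using lim by (rule order_tendstoD) simp
  then obtain d0 where d0: "\<And>n. n \<ge> d0 \<Longrightarrow> (\<integral>\<^sup>+x. ennreal ((norm (X n x - f x))\<^sup>2) \<partial>M) < \<infinity>"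
    by (auto simp: eventually_sequentially)
  have sd: "square_integrable M (\<lambda>x. X n x - f x)" if "n \<ge> d0" for n
    using d0[OF that] X[of n] f
    by (auto simp: square_integrable_def intro!: integrableI_bounded)
  have sf: "square_integrable M f"
    using square_integrable_diff[OF X[of d0] sd[of d0]] by simp
  have "l2_tendsto M (\<lambda>n. X (n + d)) f" if d: "d \<ge> d0" for d
  proof -
    have "(LINT x|M. (norm (X (n + d) x - f x))\<^sup>2) =
        enn2real (\<integral>\<^sup>+x. ennreal ((norm (X (n + d) x - f x))\<^sup>2) \<partial>M)" for n
      using sd[of "n + d"] d
      by (intro integral_eq_nn_integral) (auto simp: square_integrable_def)
    moreover have "(\<lambda>n. enn2real (\<integral>\<^sup>+x. ennreal ((norm (X (n + d) x - f x))\<^sup>2) \<partial>M)) \<longlonglongrightarrow> enn2real 0"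
      by (rule tendsto_enn2real[unfolded ennreal_0]) (use LIMSEQ_ignore_initial_segment[OF lim, of d] in auto)
    ultimately show ?thesis using X sf by (simp add: l2_tendsto_def)
  qed
  then show ?thesis by blast
qed

section \<open>Increments of the Wiener process\<close>

lemma normal_density_abs: "normal_density \<mu> \<bar>\<sigma>\<bar> = normal_density \<mu> \<sigma>"
  by (simp add: normal_density_def fun_eq_iff)

text \<open>A negative \<open>v\<close> is covered as well: the density depends on \<open>sqrt v\<close> only through its
  square, so \<open>\<bar>sqrt v\<bar>\<close> may serve as the standard deviation.\<close>

lemma centered_normal_moments:
  shows centered_normal_integrable_square: "integrable (centered_normal v) (\<lambda>x. x\<^sup>2)"
    and centered_normal_mean: "(LINT x|centered_normal v. x) = 0"
proof -
  have "integrable (centered_normal v) (\<lambda>x. x\<^sup>2) \<and> (LINT x|centered_normal v. x) = 0"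
  proof (cases "v = 0")
    case True
    then show ?thesis
      by (simp add: centered_normal_def integrable_iff_bounded nn_integral_return integral_return)
  next
    case False
    then have s: "0 < \<bar>sqrt v\<bar>" by simp
    show ?thesis
      using False integrable_normal_moment[OF s, of 0 2] integral_normal_moment_odd[OF s, of 0 0]
      by (simp add: centered_normal_def normal_density_abs integrable_density integral_density)
  qed
  then show "integrable (centered_normal v) (\<lambda>x. x\<^sup>2)" "(LINT x|centered_normal v. x) = 0"
    by auto
qed

lemma integrable_bounded_mult:
  fixes f g :: "'a \<Rightarrow> real"
  assumes f: "integrable M f" and g: "g \<in> borel_measurable M"
    and c: "\<And>x. x \<in> space M \<Longrightarrow> \<bar>g x\<bar> \<le> c"
  shows "integrable M (\<lambda>x. g x * f x)"
proof (rule Bochner_Integration.integrable_bound)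
  show "integrable M (\<lambda>x. c * f x)" using f by simp
  show "(\<lambda>x. g x * f x) \<in> borel_measurable M" using f g by measurable
  have "norm (g x * f x) \<le> norm (c * f x)" if "x \<in> space M" for x
    using mult_right_mono[OF c[OF that] abs_ge_zero[of "f x"]] c[OF that]
    by (simp add: abs_mult)
  then show "AE x in M. norm (g x * f x) \<le> norm (c * f x)" by auto
qed

locale wiener_setting =
  fixes P :: "'w measure" and F :: "real \<Rightarrow> 'w measure"
    and K :: "real^'q^'q" and w :: "real \<Rightarrow> 'w \<Rightarrow> real^'q"
  assumes usual: "usual_filtered_prob_space P F"
    and wiener: "wiener_process P F K w"
begin

sublocale prob_space P
  using usual by (simp add: usual_filtered_prob_space_def)

lemma space_F: "0 \<le> t \<Longrightarrow> space (F t) = space P"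
  using usual filtration.space_F[of "space P" "\<lambda>t. F (max 0 t)" t]
  by (simp add: usual_filtered_prob_space_def max_def)

lemma sets_F_mono: "0 \<le> s \<Longrightarrow> s \<le> t \<Longrightarrow> sets (F s) \<subseteq> sets (F t)"
  using usual filtration.sets_F_mono[of "space P" "\<lambda>t. F (max 0 t)" s t]
  by (simp add: usual_filtered_prob_space_def max_def)

lemma subalgebra_F:
  assumes "0 \<le> t"
  shows "subalgebra P (F t)"
proof -
  have "\<forall>t\<ge>0. sets (F t) \<subseteq> sets P"
    using usual unfolding usual_filtered_prob_space_def by (elim conjE)
  with assms space_F[OF assms] show ?thesis unfolding subalgebra_def by iprover
qed

lemma subalgebra_F_mono: "0 \<le> s \<Longrightarrow> s \<le> t \<Longrightarrow> subalgebra (F t) (F s)"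
  using space_F[of s] space_F[of t] sets_F_mono by (simp add: subalgebra_def)

lemma measurable_of_F: "0 \<le> t \<Longrightarrow> f \<in> measurable (F t) N \<Longrightarrow> f \<in> measurable P N"
  by (rule measurable_from_subalg[OF subalgebra_F])

lemma measurable_F_mono: "f \<in> measurable (F s) N \<Longrightarrow> 0 \<le> s \<Longrightarrow> s \<le> t \<Longrightarrow> f \<in> measurable (F t) N"
  by (rule measurable_from_subalg[OF subalgebra_F_mono])

definition incr :: "'q \<Rightarrow> real \<Rightarrow> real \<Rightarrow> 'w \<Rightarrow> real"
  where "incr i a b \<omega> = w b \<omega> $ i - w a \<omega> $ i"

lemma w_measurable: "0 \<le> t \<Longrightarrow> w t \<in> borel_measurable (F t)"
  using wiener by (simp add: wiener_process_def)

lemma incr_measurable: "0 \<le> a \<Longrightarrow> a \<le> b \<Longrightarrow> incr i a b \<in> borel_measurable (F b)"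
  unfolding incr_def
  by (intro borel_measurable_diff borel_measurable_continuous_on[OF _ w_measurable]
      borel_measurable_continuous_on[OF _ measurable_F_mono[OF w_measurable]] continuous_intros) auto

lemma incr_random_variable: "0 \<le> a \<Longrightarrow> a \<le> b \<Longrightarrow> incr i a b \<in> borel_measurable P"
  using measurable_of_F[OF _ incr_measurable] by simp

lemma incr_moments:
  assumes ab: "0 \<le> a" "a \<le> b"
  shows square_integrable_incr: "square_integrable P (incr i a b)"
    and expectation_incr: "expectation (incr i a b) = 0"
proof -
  have inc: "incr i a b = (\<lambda>\<omega>. axis i 1 \<bullet> (w (a + (b - a)) \<omega> - w a \<omega>))"
    by (simp add: incr_def inner_axis' fun_eq_iff)
  define v where "v = (b - a) * (axis i 1 \<bullet> (K *v axis i 1))"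
  have d: "distr P borel (incr i a b) = centered_normal v"
  proof -
    have "\<forall>t\<ge>0. \<forall>h\<ge>0. \<forall>v. distr P borel (\<lambda>\<omega>. v \<bullet> (w (t + h) \<omega> - w t \<omega>))
        = centered_normal (h * (v \<bullet> (K *v v)))"
      using wiener unfolding wiener_process_def by blast
    then show ?thesis unfolding inc v_def using ab diff_ge_0_iff_ge by blast
  qed
  note rv = incr_random_variable[OF ab, of i]
  have "integrable P (\<lambda>\<omega>. (incr i a b \<omega>)\<^sup>2)"
    using centered_normal_integrable_square[of v] rv
    unfolding d[symmetric] by (subst (asm) integrable_distr_eq) auto
  with rv show "square_integrable P (incr i a b)" by (simp add: square_integrable_def)
  show "expectation (incr i a b) = 0"
    using centered_normal_mean[of v] rv
    unfolding d[symmetric] by (subst (asm) integral_distr) auto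
qed

lemma integrable_incr: "0 \<le> a \<Longrightarrow> a \<le> b \<Longrightarrow> integrable P (incr i a b)"
  using integrable_inner[OF square_integrable_incr square_integrable_bounded[of "\<lambda>_. 1::real" 1], of a b i]
  by simp

lemma integrable_incr_mult:
  "0 \<le> a \<Longrightarrow> a \<le> b \<Longrightarrow> 0 \<le> c \<Longrightarrow> c \<le> d \<Longrightarrow> integrable P (\<lambda>\<omega>. incr i a b \<omega> * incr j c d \<omega>)"
  using integrable_inner[OF square_integrable_incr square_integrable_incr, of a b c d i j] by simp

text \<open>The increment after \<open>s\<close> is independent of the past \<open>F s\<close>, so means of products factor.\<close>

lemma expectation_mult_increment:
  fixes g :: "'w \<Rightarrow> real"
  assumes ts: "0 \<le> s" "s \<le> t" and g: "g \<in> borel_measurable (F s)" "integrable P g"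
    and \<phi>: "\<phi> \<in> borel_measurable borel" "integrable P (\<lambda>\<omega>. \<phi> (w t \<omega> - w s \<omega>))"
  shows "expectation (\<lambda>\<omega>. g \<omega> * \<phi> (w t \<omega> - w s \<omega>)) =
      expectation g * expectation (\<lambda>\<omega>. \<phi> (w t \<omega> - w s \<omega>))"
proof -
  let ?D = "\<lambda>\<omega>. w t \<omega> - w s \<omega>"
  have "indep_set (sets (F s)) (sets (vimage_algebra (space P) (\<lambda>\<omega>. w (s + (t - s)) \<omega> - w s \<omega>) borel))"
    using wiener ts unfolding wiener_process_def by (metis diff_ge_0_iff_ge)
  then have ind: "indep_set (sets (F s)) (sets (vimage_algebra (space P) ?D borel))" by simp
  have D: "?D \<in> borel_measurable P"
    using measurable_of_F[OF _ w_measurable] ts by (intro borel_measurable_diff) auto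
  have gP: "g \<in> borel_measurable P" by (rule measurable_of_F[OF ts(1) g(1)])
  have A: "{g -` A \<inter> space P |A. A \<in> sets borel} \<subseteq> sets (F s)"
    using g(1) space_F[OF ts(1)] by (auto dest: measurable_sets)
  have B: "{(\<lambda>\<omega>. \<phi> (?D \<omega>)) -` A \<inter> space P |A. A \<in> sets borel}
      \<subseteq> sets (vimage_algebra (space P) ?D borel)"
  proof safe
    fix A :: "real set" assume "A \<in> sets borel"
    then have "\<phi> -` A \<in> sets borel" using \<phi>(1) measurable_sets[of \<phi> borel borel A] by simp
    then have "?D -` (\<phi> -` A) \<inter> space P \<in> sets (vimage_algebra (space P) ?D borel)"
      by (rule in_vimage_algebra)
    also have "?D -` (\<phi> -` A) \<inter> space P = (\<lambda>\<omega>. \<phi> (?D \<omega>)) -` A \<inter> space P" by auto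
    finally show "(\<lambda>\<omega>. \<phi> (?D \<omega>)) -` A \<inter> space P \<in> sets (vimage_algebra (space P) ?D borel)" .
  qed
  have A': "sigma_sets (space P) {g -` A \<inter> space P |A. A \<in> sets borel} \<subseteq> sets (F s)"
    using sets.sigma_sets_subset[OF A] space_F[OF ts(1)] by simp
  have B': "sigma_sets (space P) {(\<lambda>\<omega>. \<phi> (?D \<omega>)) -` A \<inter> space P |A. A \<in> sets borel}
      \<subseteq> sets (vimage_algebra (space P) ?D borel)"
    using sets.sigma_sets_subset[OF B] by simp
  have "indep_var borel g borel (\<lambda>\<omega>. \<phi> (?D \<omega>))"
    unfolding indep_var_eq
  proof (intro conjI)
    show "random_variable borel g" by (rule gP)
    show "random_variable borel (\<lambda>\<omega>. \<phi> (?D \<omega>))" using measurable_compose[OF D \<phi>(1)] by simp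
    show "indep_set (sigma_sets (space P) {g -` A \<inter> space P |A. A \<in> sets borel})
        (sigma_sets (space P) {(\<lambda>\<omega>. \<phi> (?D \<omega>)) -` A \<inter> space P |A. A \<in> sets borel})"
      using ind A' B' unfolding indep_set_def
      by (elim indep_sets_mono_sets) (auto split: bool.split)
  qed
  from indep_var_lebesgue_integral[OF this g(2) \<phi>(2)]
  show "expectation (\<lambda>\<omega>. g \<omega> * \<phi> (?D \<omega>)) = expectation g * expectation (\<lambda>\<omega>. \<phi> (?D \<omega>))"
    by simp
qed

lemma expectation_past_times_incr:
  fixes g :: "'w \<Rightarrow> real"
  assumes ts: "0 \<le> s" "s \<le> t" and g: "g \<in> borel_measurable (F s)" "integrable P g"
  shows "expectation (\<lambda>\<omega>. g \<omega> * incr i s t \<omega>) = 0"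
proof -
  have m: "(\<lambda>v::real^'q. v $ i) \<in> borel_measurable borel"
    by (intro borel_measurable_continuous_onI continuous_intros)
  have i: "incr i s t = (\<lambda>\<omega>. (w t \<omega> - w s \<omega>) $ i)" by (simp add: incr_def fun_eq_iff)
  from expectation_mult_increment[OF ts g m] integrable_incr[OF ts, of i] expectation_incr[OF ts, of i]
  show "expectation (\<lambda>\<omega>. g \<omega> * incr i s t \<omega>) = 0"
    unfolding i by simp_all
qed

lemma w_AE_eq_incr: "AE \<omega> in P. w t \<omega> $ i = incr i 0 t \<omega>"
  using wiener unfolding wiener_process_def incr_def by auto

lemma expectation_incr_from_0:
  assumes "0 \<le> t"
  shows "expectation (\<lambda>\<omega>. incr i 0 t \<omega> * incr j 0 t \<omega>) = K $ i $ j * t"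
proof -
  have "expectation (\<lambda>\<omega>. incr i 0 t \<omega> * incr j 0 t \<omega>) = expectation (\<lambda>\<omega>. w t \<omega> $ i * w t \<omega> $ j)"
  proof (rule integral_cong_AE)
    show "(\<lambda>\<omega>. incr i 0 t \<omega> * incr j 0 t \<omega>) \<in> borel_measurable P"
      using integrable_incr_mult assms by blast
    show "(\<lambda>\<omega>. w t \<omega> $ i * w t \<omega> $ j) \<in> borel_measurable P"
      using measurable_of_F[OF assms w_measurable[OF assms]]
      by (intro borel_measurable_times borel_measurable_continuous_on[of "\<lambda>v. v $ _"] continuous_intros)
    show "AE \<omega> in P. incr i 0 t \<omega> * incr j 0 t \<omega> = w t \<omega> $ i * w t \<omega> $ j"
      using w_AE_eq_incr[of t i] w_AE_eq_incr[of t j] by eventually_elim simp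
  qed
  with wiener assms show ?thesis by (simp add: wiener_process_def)
qed

lemma K_symmetric: "K $ i $ j = K $ j $ i"
  using expectation_incr_from_0[of 1 i j] expectation_incr_from_0[of 1 j i]
  by (simp add: mult.commute)

text \<open>The covariance is given only for the values at one time. Expanding
  \<open>w(b) = w(a) + (w(b) - w(a))\<close> transfers it to increments, because the mixed terms have mean zero.\<close>

lemma expectation_incr_mult_incr:
  assumes ab: "0 \<le> a" "a \<le> b"
  shows "expectation (\<lambda>\<omega>. incr i a b \<omega> * incr j a b \<omega>) = K $ i $ j * (b - a)"
proof -
  have z: "expectation (\<lambda>\<omega>. incr k 0 a \<omega> * incr l a b \<omega>) = 0"
    "integrable P (\<lambda>\<omega>. incr k 0 a \<omega> * incr l a b \<omega>)" for k l
    using expectation_past_times_incr[OF ab incr_measurable integrable_incr]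
      integrable_incr_mult ab by auto
  have int: "integrable P (\<lambda>\<omega>. incr i 0 a \<omega> * incr j 0 a \<omega>)" "integrable P (\<lambda>\<omega>. incr i a b \<omega> * incr j a b \<omega>)"
    using integrable_incr_mult ab by auto
  have "(\<lambda>\<omega>. incr i 0 b \<omega> * incr j 0 b \<omega>) = (\<lambda>\<omega>. incr i 0 a \<omega> * incr j 0 a \<omega>
      + incr i 0 a \<omega> * incr j a b \<omega> + incr j 0 a \<omega> * incr i a b \<omega> + incr i a b \<omega> * incr j a b \<omega>)"
    by (simp add: incr_def fun_eq_iff algebra_simps)
  then have "expectation (\<lambda>\<omega>. incr i 0 b \<omega> * incr j 0 b \<omega>) =
      expectation (\<lambda>\<omega>. incr i 0 a \<omega> * incr j 0 a \<omega>) + expectation (\<lambda>\<omega>. incr i a b \<omega> * incr j a b \<omega>)"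
    using z[of i j] z[of j i] int by simp
  then show ?thesis
    using expectation_incr_from_0[of b i j] expectation_incr_from_0[of a i j] ab
    by (simp add: algebra_simps)
qed

lemma expectation_past_times_incr2:
  fixes g :: "'w \<Rightarrow> real"
  assumes ts: "0 \<le> s" "s \<le> t" and g: "g \<in> borel_measurable (F s)" "integrable P g"
  shows "expectation (\<lambda>\<omega>. g \<omega> * (incr i s t \<omega> * incr j s t \<omega>)) = expectation g * (K $ i $ j * (t - s))"
proof -
  have m: "(\<lambda>v::real^'q. v $ i * v $ j) \<in> borel_measurable borel"
    by (intro borel_measurable_continuous_onI continuous_intros)
  have i: "incr i s t = (\<lambda>\<omega>. (w t \<omega> - w s \<omega>) $ i)" for i by (simp add: incr_def fun_eq_iff)
  from expectation_mult_increment[OF ts g m] integrable_incr_mult[OF ts ts, of i j]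
    expectation_incr_mult_incr[OF ts, of i j]
  show "expectation (\<lambda>\<omega>. g \<omega> * (incr i s t \<omega> * incr j s t \<omega>)) = expectation g * (K $ i $ j * (t - s))"
    unfolding i by simp_all
qed

text \<open>Cut both intervals at \<open>c\<close> and at the end \<open>e\<close> of the overlap \<open>(c,e]\<close>. Products of increments over
  consecutive pieces have mean zero, as the later piece is independent of all that precedes it; what
  remains is the product over the overlap.\<close>

lemma expectation_past_times_two_incr_ordered:
  fixes g :: "'w \<Rightarrow> real"
  assumes ab: "0 \<le> a" "a \<le> b" and cd: "a \<le> c" "c \<le> d"
    and g: "g \<in> borel_measurable (F c)" and bd: "\<And>\<omega>. \<omega> \<in> space P \<Longrightarrow> \<bar>g \<omega>\<bar> \<le> B"
  shows "expectation (\<lambda>\<omega>. g \<omega> * (incr i a b \<omega> * incr j c d \<omega>)) =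
    K $ i $ j * measure lborel ({a<..b} \<inter> {c<..d}) * expectation g"
proof -
  have c0: "0 \<le> c" using ab cd by simp
  have gP: "g \<in> borel_measurable P" by (rule measurable_of_F[OF c0 g])
  have gint: "integrable P g"
    using integrable_bounded_mult[OF integrable_const[of 1] gP bd] by simp
  have gX: "integrable P (\<lambda>\<omega>. g \<omega> * incr k s t \<omega>)" if "0 \<le> s" "s \<le> t" for k s t
    by (rule integrable_bounded_mult[OF integrable_incr[OF that] gP bd])
  have gXY: "integrable P (\<lambda>\<omega>. g \<omega> * (incr k s t \<omega> * incr l s' t' \<omega>))"
    if "0 \<le> s" "s \<le> t" "0 \<le> s'" "s' \<le> t'" for k l s t s' t'
    by (rule integrable_bounded_mult[OF integrable_incr_mult[OF that] gP bd])
  have disj: "expectation (\<lambda>\<omega>. g \<omega> * (incr k s t \<omega> * incr l s' t' \<omega>)) = 0"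
    if "0 \<le> s" "s \<le> t" "t \<le> s'" "s' \<le> t'" "c \<le> s'" for k l s t s' t'
  proof -
    have "(\<lambda>\<omega>. g \<omega> * incr k s t \<omega>) \<in> borel_measurable (F s')"
      by (rule borel_measurable_times[OF measurable_F_mono[OF g c0 that(5)]
            measurable_F_mono[OF incr_measurable[OF that(1,2)] _ that(3)]]) (use that in simp)
    then have "expectation (\<lambda>\<omega>. g \<omega> * incr k s t \<omega> * incr l s' t' \<omega>) = 0"
      using that by (intro expectation_past_times_incr gX) auto
    then show ?thesis by (simp add: mult.assoc)
  qed
  show ?thesis
  proof (cases "b \<le> c")
    case True
    then have "{a<..b} \<inter> {c<..d} = {}" by auto
    then show ?thesis using disj[of a b c d i j] ab cd True by simp
  next
    case False
    define e where "e = min b d"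
    have e: "c \<le> e" "e \<le> b" "e \<le> d" "e = b \<or> e = d" using False cd by (auto simp: e_def)
    have m: "measure lborel ({a<..b} \<inter> {c<..d}) = e - c"
    proof -
      have "{a<..b} \<inter> {c<..d} = {c<..e}" using cd by (auto simp: e_def)
      then show ?thesis using e by simp
    qed
    \<comment> \<open>The product of the two pieces after \<open>e\<close> is missing because one of them is empty.\<close>
    have "(\<lambda>\<omega>. g \<omega> * (incr i a b \<omega> * incr j c d \<omega>)) = (\<lambda>\<omega>.
        g \<omega> * (incr i a c \<omega> * incr j c d \<omega>) + g \<omega> * (incr i c e \<omega> * incr j c e \<omega>)
        + g \<omega> * (incr i c e \<omega> * incr j e d \<omega>) + g \<omega> * (incr j c e \<omega> * incr i e b \<omega>))"
      using e(4) by (auto simp: incr_def fun_eq_iff algebra_simps)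
    then have "expectation (\<lambda>\<omega>. g \<omega> * (incr i a b \<omega> * incr j c d \<omega>)) =
        expectation (\<lambda>\<omega>. g \<omega> * (incr i a c \<omega> * incr j c d \<omega>))
        + expectation (\<lambda>\<omega>. g \<omega> * (incr i c e \<omega> * incr j c e \<omega>))
        + expectation (\<lambda>\<omega>. g \<omega> * (incr i c e \<omega> * incr j e d \<omega>))
        + expectation (\<lambda>\<omega>. g \<omega> * (incr j c e \<omega> * incr i e b \<omega>))"
      using gXY ab cd e c0 by simp
    also have "\<dots> = expectation g * (K $ i $ j * (e - c))"
      using disj[of a c c d i j] disj[of c e e d i j] disj[of c e e b j i] ab cd e c0
        expectation_past_times_incr2[OF c0 e(1) g gint, of i j] by simp
    finally show ?thesis unfolding m by simp
  qed
qed

lemma expectation_past_times_two_incr: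
  fixes g :: "'w \<Rightarrow> real"
  assumes ab: "0 \<le> a" "a \<le> b" and cd: "0 \<le> c" "c \<le> d"
    and g: "g \<in> borel_measurable (F (max a c))" and bd: "\<And>\<omega>. \<omega> \<in> space P \<Longrightarrow> \<bar>g \<omega>\<bar> \<le> B"
  shows "expectation (\<lambda>\<omega>. g \<omega> * (incr i a b \<omega> * incr j c d \<omega>)) =
    K $ i $ j * measure lborel ({a<..b} \<inter> {c<..d}) * expectation g"
proof (cases "a \<le> c")
  case True
  with g have "g \<in> borel_measurable (F c)" by (simp add: max_def)
  from expectation_past_times_two_incr_ordered[OF ab True cd(2) this bd] show ?thesis by simp
next
  case False
  with g have "g \<in> borel_measurable (F a)" by (simp add: max_def)
  from expectation_past_times_two_incr_ordered[OF cd _ ab(2) this bd, of j i] False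
  show ?thesis by (simp add: K_symmetric[of j i] Int_commute mult.commute[of "incr j c d _"])
qed

end

section \<open>Elementary integrals\<close>

text \<open>A list of triples \<open>(a, b, \<xi>)\<close> stands for the integrand \<open>\<Sum> 1\<^bsub>(a,b]\<^esub> \<xi>\<close>. The intervals are
  arbitrary, not cells of one partition: differences are then formed by appending lists, and integrands
  on different partitions need no common refinement.\<close>

definition elem_val :: "(real \<times> real \<times> ('w \<Rightarrow> 'b::euclidean_space)) list \<Rightarrow> real \<times> 'w \<Rightarrow> 'b"
  where "elem_val L p = (\<Sum>(a, b, \<xi>)\<leftarrow>L. indicator {a<..b} (fst p) *\<^sub>R \<xi> (snd p))"

definition map_coeff ::
    "('w \<Rightarrow> 'b \<Rightarrow> 'c) \<Rightarrow> (real \<times> real \<times> ('w \<Rightarrow> 'b)) list \<Rightarrow> (real \<times> real \<times> ('w \<Rightarrow> 'c)) list"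
  where "map_coeff h L = map (\<lambda>(a, b, \<xi>). (a, b, \<lambda>\<omega>. h \<omega> (\<xi> \<omega>))) L"

definition after_time ::
    "real \<Rightarrow> (real \<times> real \<times> ('w \<Rightarrow> 'b)) list \<Rightarrow> (real \<times> real \<times> ('w \<Rightarrow> 'b)) list"
  where "after_time r L = map (\<lambda>(a, b, \<xi>). (max a r, max b r, \<xi>)) L"

lemma elem_val_Nil [simp]: "elem_val [] p = 0"
  and elem_val_Cons [simp]: "elem_val ((a, b, \<xi>) # L) p =
    indicator {a<..b} (fst p) *\<^sub>R \<xi> (snd p) + elem_val L p"
  and elem_val_append: "elem_val (L @ L') p = elem_val L p + elem_val L' p"
  by (simp_all add: elem_val_def)

lemma elem_val_map_coeff:
  assumes "\<And>\<omega>. linear (h \<omega>)"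
  shows "elem_val (map_coeff h L) p = h (snd p) (elem_val L p)"
  using assms
  by (induction L) (auto simp: map_coeff_def linear_0 linear_add linear_scale)

text \<open>Moving the left ends to \<open>r\<close> keeps the coefficients measurable with respect to the past; moving the
  right ends as well empties the intervals that end before \<open>r\<close>.\<close>

lemma elem_val_after_time:
  "elem_val (after_time r L) p = indicator {r<..} (fst p) *\<^sub>R elem_val L p"
  by (induction L) (auto simp: after_time_def indicator_def algebra_simps)

context wiener_setting
begin

sublocale LP: pair_sigma_finite lborel P ..

abbreviation LP :: "(real \<times> 'w) measure" where "LP \<equiv> lborel \<Otimes>\<^sub>M P"

definition adapted_list :: "real \<Rightarrow> (real \<times> real \<times> ('w \<Rightarrow> 'b::euclidean_space)) list \<Rightarrow> bool"
  where "adapted_list s L \<longleftrightarrow> (\<forall>(a, b, \<xi>)\<in>set L. s \<le> a \<and> a \<le> b \<and>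
    \<xi> \<in> borel_measurable (F a) \<and> (\<exists>c. \<forall>\<omega>\<in>space P. norm (\<xi> \<omega>) \<le> c))"

definition elem_int :: "'q \<Rightarrow> (real \<times> real \<times> ('w \<Rightarrow> 'b::euclidean_space)) list \<Rightarrow> 'w \<Rightarrow> 'b"
  where "elem_int i L \<omega> = (\<Sum>(a, b, \<xi>)\<leftarrow>L. incr i a b \<omega> *\<^sub>R \<xi> \<omega>)"

lemma elem_int_Nil [simp]: "elem_int i [] \<omega> = 0"
  and elem_int_Cons [simp]: "elem_int i ((a, b, \<xi>) # L) \<omega> = incr i a b \<omega> *\<^sub>R \<xi> \<omega> + elem_int i L \<omega>"
  and elem_int_append: "elem_int i (L @ L') \<omega> = elem_int i L \<omega> + elem_int i L' \<omega>"
  by (simp_all add: elem_int_def)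

lemma elem_int_map_coeff:
  assumes "\<And>\<omega>. linear (h \<omega>)"
  shows "elem_int i (map_coeff h L) \<omega> = h \<omega> (elem_int i L \<omega>)"
  using assms
  by (induction L) (auto simp: map_coeff_def linear_0 linear_add linear_scale)

lemma adapted_list_Nil [simp]: "adapted_list s []"
  and adapted_list_Cons [simp]: "adapted_list s ((a, b, \<xi>) # L) \<longleftrightarrow> s \<le> a \<and> a \<le> b \<and>
    \<xi> \<in> borel_measurable (F a) \<and> (\<exists>c. \<forall>\<omega>\<in>space P. norm (\<xi> \<omega>) \<le> c) \<and> adapted_list s L"
  and adapted_list_append: "adapted_list s (L @ L') \<longleftrightarrow> adapted_list s L \<and> adapted_list s L'"
  by (simp_all add: adapted_list_def ball_Un)

lemma adapted_list_mono: "adapted_list s L \<Longrightarrow> r \<le> s \<Longrightarrow> adapted_list r L"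
  by (induction L) auto

lemma adapted_list_map_coeff:
  assumes L: "adapted_list s L"
    and m: "\<And>a \<xi>. s \<le> a \<Longrightarrow> \<xi> \<in> borel_measurable (F a) \<Longrightarrow> (\<lambda>\<omega>. h \<omega> (\<xi> \<omega>)) \<in> borel_measurable (F a)"
    and c: "\<And>\<omega> x. \<omega> \<in> space P \<Longrightarrow> norm (h \<omega> x) \<le> c * norm x" and c0: "0 \<le> c"
  shows "adapted_list s (map_coeff h L)"
  using L
proof (induction L)
  case Nil
  then show ?case by (simp add: map_coeff_def)
next
  case (Cons x L)
  obtain a b \<xi> where x: "x = (a, b, \<xi>)" by (cases x) auto
  from Cons.prems x obtain B where B: "\<forall>\<omega>\<in>space P. norm (\<xi> \<omega>) \<le> B" by auto
  have "norm (h \<omega> (\<xi> \<omega>)) \<le> c * B" if "\<omega> \<in> space P" for \<omega>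
    using c[OF that, of "\<xi> \<omega>"] mult_left_mono[OF bspec[OF B that] c0] by linarith
  then have "\<exists>B. \<forall>\<omega>\<in>space P. norm (h \<omega> (\<xi> \<omega>)) \<le> B" by blast
  with Cons x m show ?case by (auto simp: map_coeff_def)
qed

lemma adapted_list_after_time:
  assumes "adapted_list s L" "0 \<le> s"
  shows "adapted_list (max s r) (after_time r L)"
  using assms(1)
proof (induction L)
  case Nil
  then show ?case by (simp add: after_time_def)
next
  case (Cons x L)
  obtain a b \<xi> where x: "x = (a, b, \<xi>)" by (cases x) auto
  with Cons.prems have \<xi>: "\<xi> \<in> borel_measurable (F a)" and "s \<le> a" by auto
  then have "\<xi> \<in> borel_measurable (F (max a r))"
    using assms(2) by (intro measurable_F_mono[OF \<xi>]) auto
  with Cons x show ?case by (auto simp: after_time_def)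
qed

lemma measurable_snd_P: "f \<in> borel_measurable P \<Longrightarrow> (\<lambda>p. f (snd p)) \<in> borel_measurable LP"
  by (rule measurable_compose[OF measurable_snd])

lemma integrable_LP_interval:
  fixes g :: "'w \<Rightarrow> real"
  assumes g: "integrable P g" and A: "A \<in> sets lborel" "emeasure lborel A < \<infinity>"
  shows "integrable LP (\<lambda>p. indicator A (fst p) * g (snd p))"
    and "(LINT p|LP. indicator A (fst p) * g (snd p)) = measure lborel A * expectation g"
proof -
  have m: "(\<lambda>p. indicator A (fst p) * g (snd p)) \<in> borel_measurable LP"
    using A g by measurable
  have "integrable LP (\<lambda>(r, \<omega>). indicator A r * g \<omega>)"
  proof (rule LP.Fubini_integrable)
    show "(\<lambda>(r, \<omega>). indicator A r * g \<omega>) \<in> borel_measurable LP"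
      using m by (simp add: case_prod_beta')
    have "(\<lambda>r. \<integral>\<omega>. norm (case (r, \<omega>) of (r, \<omega>) \<Rightarrow> indicator A r * g \<omega>) \<partial>P) =
        (\<lambda>r. indicator A r * (\<integral>\<omega>. \<bar>g \<omega>\<bar> \<partial>P))"
      by (auto simp: abs_mult fun_eq_iff indicator_def)
    then show "integrable lborel (\<lambda>r. \<integral>\<omega>. norm (case (r, \<omega>) of (r, \<omega>) \<Rightarrow> indicator A r * g \<omega>) \<partial>P)"
      using A by simp
    show "AE r in lborel. integrable P (\<lambda>\<omega>. case (r, \<omega>) of (r, \<omega>) \<Rightarrow> indicator A r * g \<omega>)"
      using g by simp
  qed
  then show *: "integrable LP (\<lambda>p. indicator A (fst p) * g (snd p))"
    by (simp add: case_prod_beta')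
  show "(LINT p|LP. indicator A (fst p) * g (snd p)) = measure lborel A * expectation g"
    using LP.integral_fst'[OF *] A by simp
qed

lemma square_integrable_elem_val:
  assumes "0 \<le> s" "adapted_list s L"
  shows "square_integrable LP (elem_val L)"
  using assms(2)
proof (induction L)
  case Nil
  then show ?case using square_integrable_zero by simp
next
  case (Cons x L)
  obtain a b \<xi> where x: "x = (a, b, \<xi>)" by (cases x) auto
  with Cons.prems obtain c where c: "\<And>\<omega>. \<omega> \<in> space P \<Longrightarrow> norm (\<xi> \<omega>) \<le> c" by auto
  have \<xi>: "\<xi> \<in> borel_measurable P"
    using Cons.prems x assms(1) by (intro measurable_of_F[of a]) auto
  have "square_integrable LP (\<lambda>p. indicator {a<..b} (fst p) *\<^sub>R \<xi> (snd p))"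
  proof (rule square_integrable_bound[where h = "\<lambda>p. indicator {a<..b} (fst p) * c\<^sup>2"])
    show "(\<lambda>p. indicator {a<..b} (fst p) *\<^sub>R \<xi> (snd p)) \<in> borel_measurable LP"
      using \<xi> by measurable
    show "integrable LP (\<lambda>p. indicator {a<..b} (fst p) * c\<^sup>2)"
      by (rule integrable_LP_interval(1)) (use Cons.prems x in auto)
    show "AE p in LP. (norm (indicator {a<..b} (fst p) *\<^sub>R \<xi> (snd p)))\<^sup>2 \<le> indicator {a<..b} (fst p) * c\<^sup>2"
    proof (rule AE_I2)
      fix p assume "p \<in> space LP"
      then have "norm (\<xi> (snd p)) \<le> c" using c by (auto simp: space_pair_measure)
      then show "(norm (indicator {a<..b} (fst p) *\<^sub>R \<xi> (snd p)))\<^sup>2 \<le> indicator {a<..b} (fst p) * c\<^sup>2"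
        by (auto simp: indicator_def intro!: power_mono)
    qed
  qed
  moreover have "elem_val (x # L) = (\<lambda>p. indicator {a<..b} (fst p) *\<^sub>R \<xi> (snd p) + elem_val L p)"
    by (simp add: x fun_eq_iff)
  ultimately show ?case using Cons x square_integrable_add by auto
qed

lemma square_integrable_elem_int:
  assumes "0 \<le> s" "adapted_list s L"
  shows "square_integrable P (elem_int i L)"
  using assms(2)
proof (induction L)
  case Nil
  then show ?case using square_integrable_zero by simp
next
  case (Cons x L)
  obtain a b \<xi> where x: "x = (a, b, \<xi>)" by (cases x) auto
  with Cons.prems obtain c where c: "\<And>\<omega>. \<omega> \<in> space P \<Longrightarrow> norm (\<xi> \<omega>) \<le> c" by auto
  have ab: "0 \<le> a" "a \<le> b" using Cons.prems x assms(1) by auto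
  have \<xi>: "\<xi> \<in> borel_measurable P"
    using Cons.prems x assms(1) by (intro measurable_of_F[of a]) auto
  have "square_integrable P (\<lambda>\<omega>. incr i a b \<omega> *\<^sub>R \<xi> \<omega>)"
  proof (rule square_integrable_bound[where h = "\<lambda>\<omega>. (incr i a b \<omega>)\<^sup>2 * c\<^sup>2"])
    show "(\<lambda>\<omega>. incr i a b \<omega> *\<^sub>R \<xi> \<omega>) \<in> borel_measurable P"
      using \<xi> incr_random_variable[OF ab] by measurable
    show "integrable P (\<lambda>\<omega>. (incr i a b \<omega>)\<^sup>2 * c\<^sup>2)"
      using square_integrable_norm[OF square_integrable_incr[OF ab, of i]] by simp
    show "AE \<omega> in P. (norm (incr i a b \<omega> *\<^sub>R \<xi> \<omega>))\<^sup>2 \<le> (incr i a b \<omega>)\<^sup>2 * c\<^sup>2"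
      using c by (auto simp: power_mult_distrib intro!: mult_left_mono power_mono)
  qed
  moreover have "elem_int i (x # L) = (\<lambda>\<omega>. incr i a b \<omega> *\<^sub>R \<xi> \<omega> + elem_int i L \<omega>)"
    by (simp add: x fun_eq_iff)
  ultimately show ?case using Cons x square_integrable_add by auto
qed

text \<open>Correlations of increments over two intervals are \<open>K\<close> times the length of the overlap, so this
  holds term by term.\<close>

lemma elem_isometry_single:
  assumes s: "0 \<le> s" and L: "adapted_list s [(a, b, \<xi>)]" and L': "adapted_list s [(c, d, \<zeta>)]"
  shows "expectation (\<lambda>\<omega>. elem_int i [(a, b, \<xi>)] \<omega> \<bullet> elem_int j [(c, d, \<zeta>)] \<omega>) =
    K $ i $ j * (LINT p|LP. elem_val [(a, b, \<xi>)] p \<bullet> elem_val [(c, d, \<zeta>)] p)"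
proof -
  let ?g = "\<lambda>\<omega>. \<xi> \<omega> \<bullet> \<zeta> \<omega>"
  from L L' obtain B B' where B: "\<And>\<omega>. \<omega> \<in> space P \<Longrightarrow> norm (\<xi> \<omega>) \<le> B"
    and B': "\<And>\<omega>. \<omega> \<in> space P \<Longrightarrow> norm (\<zeta> \<omega>) \<le> B'" by auto
  have ab: "0 \<le> a" "a \<le> b" and cd: "0 \<le> c" "c \<le> d" using s L L' by auto
  have \<xi>: "\<xi> \<in> borel_measurable (F a)" and \<zeta>: "\<zeta> \<in> borel_measurable (F c)" using L L' by auto
  have g: "?g \<in> borel_measurable (F (max a c))"
    by (rule borel_measurable_inner[OF measurable_F_mono[OF \<xi> ab(1)] measurable_F_mono[OF \<zeta> cd(1)]])
      simp_all
  have bd: "\<bar>?g \<omega>\<bar> \<le> B * B'" if "\<omega> \<in> space P" for \<omega>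
    using Cauchy_Schwarz_ineq2[of "\<xi> \<omega>" "\<zeta> \<omega>"]
      mult_mono[OF B[OF that] B'[OF that] order_trans[OF norm_ge_zero B[OF that]] norm_ge_zero]
    by linarith
  have gP: "?g \<in> borel_measurable P" using measurable_of_F[OF _ g] ab by simp
  have gi: "integrable P ?g"
    using integrable_bounded_mult[OF integrable_const[of 1] gP bd] by simp
  have "expectation (\<lambda>\<omega>. elem_int i [(a, b, \<xi>)] \<omega> \<bullet> elem_int j [(c, d, \<zeta>)] \<omega>) =
      expectation (\<lambda>\<omega>. ?g \<omega> * (incr i a b \<omega> * incr j c d \<omega>))"
    by (simp add: mult_ac)
  also have "\<dots> = K $ i $ j * (measure lborel ({a<..b} \<inter> {c<..d}) * expectation ?g)"
    by (subst expectation_past_times_two_incr[OF ab cd g bd]) simp_all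
  also have "measure lborel ({a<..b} \<inter> {c<..d}) * expectation ?g =
      (LINT p|LP. indicator ({a<..b} \<inter> {c<..d}) (fst p) * ?g (snd p))"
    using gi by (intro integrable_LP_interval(2)[symmetric])
      (use ab in \<open>auto intro: le_less_trans[OF emeasure_mono, of _ "{a<..b}"]\<close>)
  also have "\<dots> = (LINT p|LP. elem_val [(a, b, \<xi>)] p \<bullet> elem_val [(c, d, \<zeta>)] p)"
    by (intro Bochner_Integration.integral_cong) (auto simp: indicator_def)
  finally show ?thesis .
qed

lemma elem_isometry:
  assumes s: "0 \<le> s" and L: "adapted_list s L" and L': "adapted_list s L'"
  shows "expectation (\<lambda>\<omega>. elem_int i L \<omega> \<bullet> elem_int j L' \<omega>) =
    K $ i $ j * (LINT p|LP. elem_val L p \<bullet> elem_val L' p)"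
proof -
  have single: "expectation (\<lambda>\<omega>. elem_int i [x] \<omega> \<bullet> elem_int j L' \<omega>) =
      K $ i $ j * (LINT p|LP. elem_val [x] p \<bullet> elem_val L' p)" if x: "adapted_list s [x]" for x
    using L'
  proof (induction L')
    case Nil
    then show ?case by simp
  next
    case (Cons y L')
    have y: "adapted_list s [y]" "adapted_list s L'"
      using Cons.prems adapted_list_append[of s "[y]" L'] by auto
    have Y: "elem_int j (y # L') \<omega> = elem_int j [y] \<omega> + elem_int j L' \<omega>"
      "elem_val (y # L') p = elem_val [y] p + elem_val L' p" for \<omega> p
      using elem_int_append[of j "[y]" L'] elem_val_append[of "[y]" L'] by simp_all
    have "expectation (\<lambda>\<omega>. elem_int i [x] \<omega> \<bullet> elem_int j [y] \<omega>) =
        K $ i $ j * (LINT p|LP. elem_val [x] p \<bullet> elem_val [y] p)"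
      using elem_isometry_single[OF s, of "fst x" "fst (snd x)" "snd (snd x)"
          "fst y" "fst (snd y)" "snd (snd y)" i j] x y by simp
    with Cons.IH[OF y(2)] show ?case
      unfolding Y inner_add_right
      using integrable_inner[OF square_integrable_elem_int[OF s x] square_integrable_elem_int[OF s y(1)]]
        integrable_inner[OF square_integrable_elem_int[OF s x] square_integrable_elem_int[OF s y(2)]]
        integrable_inner[OF square_integrable_elem_val[OF s x] square_integrable_elem_val[OF s y(1)]]
        integrable_inner[OF square_integrable_elem_val[OF s x] square_integrable_elem_val[OF s y(2)]]
      by (simp add: distrib_left)
  qed
  show ?thesis
    using L
  proof (induction L)
    case Nil
    then show ?case by simp
  next
    case (Cons x L)
    have x: "adapted_list s [x]" "adapted_list s L"
      using Cons.prems adapted_list_append[of s "[x]" L] by auto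
    have X: "elem_int i (x # L) \<omega> = elem_int i [x] \<omega> + elem_int i L \<omega>"
      "elem_val (x # L) p = elem_val [x] p + elem_val L p" for \<omega> p
      using elem_int_append[of i "[x]" L] elem_val_append[of "[x]" L] by simp_all
    from single[OF x(1)] Cons.IH[OF x(2)] show ?case
      unfolding X inner_add_left
      using integrable_inner[OF square_integrable_elem_int[OF s x(1)] square_integrable_elem_int[OF s L']]
        integrable_inner[OF square_integrable_elem_int[OF s x(2)] square_integrable_elem_int[OF s L']]
        integrable_inner[OF square_integrable_elem_val[OF s x(1)] square_integrable_elem_val[OF s L']]
        integrable_inner[OF square_integrable_elem_val[OF s x(2)] square_integrable_elem_val[OF s L']]
      by (simp add: distrib_left)
  qed
qed

text \<open>Each coefficient is known when its interval starts, and so is its inner product with a variable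
  that is known at time \<open>s\<close>; the increment that follows has mean zero.\<close>

lemma expectation_past_inner_elem_int:
  assumes s: "0 \<le> s" and L: "adapted_list s L"
    and \<eta>: "\<eta> \<in> borel_measurable (F s)" "square_integrable P \<eta>"
  shows "expectation (\<lambda>\<omega>. \<eta> \<omega> \<bullet> elem_int i L \<omega>) = 0"
  using L
proof (induction L)
  case Nil
  then show ?case by simp
next
  case (Cons x L)
  obtain a b \<xi> where x: "x = (a, b, \<xi>)" by (cases x) auto
  with Cons.prems obtain c where c: "\<And>\<omega>. \<omega> \<in> space P \<Longrightarrow> norm (\<xi> \<omega>) \<le> c" by auto
  have ab: "0 \<le> a" "a \<le> b" "s \<le> a" and \<xi>: "\<xi> \<in> borel_measurable (F a)"
    and L: "adapted_list s L" and xs: "adapted_list s [x]"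
    using Cons.prems x s by auto
  have "(\<lambda>\<omega>. \<eta> \<omega> \<bullet> \<xi> \<omega>) \<in> borel_measurable (F a)"
    by (intro borel_measurable_inner \<xi> measurable_F_mono[OF \<eta>(1) s ab(3)])
  moreover have "integrable P (\<lambda>\<omega>. \<eta> \<omega> \<bullet> \<xi> \<omega>)"
    by (intro integrable_inner[OF \<eta>(2)] square_integrable_bounded[OF measurable_of_F[OF ab(1) \<xi>] c])
  ultimately have "expectation (\<lambda>\<omega>. \<eta> \<omega> \<bullet> \<xi> \<omega> * incr i a b \<omega>) = 0"
    by (rule expectation_past_times_incr[OF ab(1,2)])
  then have 0: "expectation (\<lambda>\<omega>. \<eta> \<omega> \<bullet> elem_int i [x] \<omega>) = 0" by (simp add: x mult.commute)
  have X: "elem_int i (x # L) \<omega> = elem_int i [x] \<omega> + elem_int i L \<omega>" for \<omega>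
    using elem_int_append[of i "[x]" L] by simp
  show ?case
    unfolding X inner_add_right
    using 0 Cons.IH[OF L] integrable_inner[OF \<eta>(2) square_integrable_elem_int[OF s xs]]
      integrable_inner[OF \<eta>(2) square_integrable_elem_int[OF s L]]
    by simp
qed

end

section \<open>Ito integrals as limits of elementary integrals\<close>

context wiener_setting
begin

text \<open>Integrands live on all of \<open>\<real> \<times> \<Omega>\<close>; an integral over \<open>[s,t]\<close> is the integral of the integrand
  cut off outside \<open>[s,t]\<close>. Integrals over intervals with different end points can then be subtracted.\<close>

definition ito_limit ::
    "real \<Rightarrow> 'q \<Rightarrow> (real \<times> 'w \<Rightarrow> 'b::euclidean_space) \<Rightarrow> ('w \<Rightarrow> 'b) \<Rightarrow> bool"
  where "ito_limit s i X S \<longleftrightarrow> (\<exists>L. (\<forall>n. adapted_list s (L n)) \<and>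
    l2_tendsto LP (\<lambda>n. elem_val (L n)) X \<and> l2_tendsto P (\<lambda>n. elem_int i (L n)) S)"

lemma ito_limitE:
  assumes "ito_limit s i X S"
  obtains L where "\<And>n. adapted_list s (L n)" "l2_tendsto LP (\<lambda>n. elem_val (L n)) X"
    "l2_tendsto P (\<lambda>n. elem_int i (L n)) S"
  using assms by (auto simp: ito_limit_def)

lemma ito_limit_square_integrable:
  assumes "ito_limit s i X S"
  shows "square_integrable LP X" "square_integrable P S"
  using assms by (auto simp: ito_limit_def l2_tendsto_def)

lemma ito_isometry:
  assumes s: "0 \<le> s" and X: "ito_limit s i X S" and Y: "ito_limit s j Y T"
  shows "expectation (\<lambda>\<omega>. S \<omega> \<bullet> T \<omega>) = K $ i $ j * (LINT p|LP. X p \<bullet> Y p)"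
proof -
  obtain L where L: "\<And>n. adapted_list s (L n)" "l2_tendsto LP (\<lambda>n. elem_val (L n)) X"
    "l2_tendsto P (\<lambda>n. elem_int i (L n)) S" using X by (rule ito_limitE) blast
  obtain L' where L': "\<And>n. adapted_list s (L' n)" "l2_tendsto LP (\<lambda>n. elem_val (L' n)) Y"
    "l2_tendsto P (\<lambda>n. elem_int j (L' n)) T" using Y by (rule ito_limitE) blast
  have "(\<lambda>n. K $ i $ j * (LINT p|LP. elem_val (L n) p \<bullet> elem_val (L' n) p))
      \<longlonglongrightarrow> K $ i $ j * (LINT p|LP. X p \<bullet> Y p)"
    by (intro tendsto_mult_left l2_tendsto_inner L L')
  moreover have "(\<lambda>n. K $ i $ j * (LINT p|LP. elem_val (L n) p \<bullet> elem_val (L' n) p))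
      \<longlonglongrightarrow> expectation (\<lambda>\<omega>. S \<omega> \<bullet> T \<omega>)"
    using l2_tendsto_inner[OF L(3) L'(3)] by (simp add: elem_isometry[OF s L(1) L'(1)])
  ultimately show ?thesis by (rule LIMSEQ_unique[symmetric])
qed

text \<open>A random linear map may be applied to an Ito integral if it is known when the integral starts: it
  then acts on the coefficients of the approximating sums.\<close>

lemma ito_limit_map_coeff:
  assumes X: "ito_limit s i X S" and lin: "\<And>\<omega>. linear (h \<omega>)"
    and m: "\<And>a \<xi>. s \<le> a \<Longrightarrow> \<xi> \<in> borel_measurable (F a) \<Longrightarrow> (\<lambda>\<omega>. h \<omega> (\<xi> \<omega>)) \<in> borel_measurable (F a)"
    and c: "\<And>\<omega> x. \<omega> \<in> space P \<Longrightarrow> norm (h \<omega> x) \<le> c * norm x" and c0: "0 \<le> c"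
    and limX: "\<And>Z. l2_tendsto LP Z X \<Longrightarrow> l2_tendsto LP (\<lambda>n p. h (snd p) (Z n p)) (\<lambda>p. h (snd p) (X p))"
    and limS: "\<And>Z. l2_tendsto P Z S \<Longrightarrow> l2_tendsto P (\<lambda>n \<omega>. h \<omega> (Z n \<omega>)) (\<lambda>\<omega>. h \<omega> (S \<omega>))"
  shows "ito_limit s i (\<lambda>p. h (snd p) (X p)) (\<lambda>\<omega>. h \<omega> (S \<omega>))"
proof -
  obtain L where L: "\<And>n. adapted_list s (L n)" "l2_tendsto LP (\<lambda>n. elem_val (L n)) X"
    "l2_tendsto P (\<lambda>n. elem_int i (L n)) S" using X by (rule ito_limitE) blast
  have "l2_tendsto LP (\<lambda>n. elem_val (map_coeff h (L n))) (\<lambda>p. h (snd p) (X p))"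
    using limX[OF L(2)] by (simp add: elem_val_map_coeff[OF lin, abs_def])
  moreover have "l2_tendsto P (\<lambda>n. elem_int i (map_coeff h (L n))) (\<lambda>\<omega>. h \<omega> (S \<omega>))"
    using limS[OF L(3)] by (simp add: elem_int_map_coeff[OF lin, abs_def])
  moreover have "adapted_list s (map_coeff h (L n))" for n
    by (rule adapted_list_map_coeff[OF L(1) m c c0])
  ultimately show ?thesis
    unfolding ito_limit_def by (intro exI[of _ "\<lambda>n. map_coeff h (L n)"]) simp
qed

lemma ito_limit_linear:
  assumes X: "ito_limit s i X S" and T: "bounded_linear T"
  shows "ito_limit s i (\<lambda>p. T (X p)) (\<lambda>\<omega>. T (S \<omega>))"
proof -
  obtain c where c: "0 < c" "\<And>x. norm (T x) \<le> norm x * c"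
    using bounded_linear.pos_bounded[OF T] by blast
  show ?thesis
  proof (rule ito_limit_map_coeff[OF X, where h = "\<lambda>_. T" and c = c])
    show "linear T" by (rule bounded_linear.linear[OF T])
    show "(\<lambda>\<omega>. T (\<xi> \<omega>)) \<in> borel_measurable (F a)" if "\<xi> \<in> borel_measurable (F a)" for a \<xi>
      by (rule borel_measurable_continuous_on[OF linear_continuous_on[OF T] that])
  qed (use c in \<open>auto intro: l2_tendsto_linear[OF _ T] simp: mult.commute\<close>)
qed

lemma ito_limit_scaleR:
  fixes X :: "real \<times> 'w \<Rightarrow> 'b::euclidean_space"
  assumes s: "0 \<le> s" and X: "ito_limit s i X S" and \<eta>: "\<eta> \<in> borel_measurable (F s)"
    and c: "\<And>\<omega>. \<omega> \<in> space P \<Longrightarrow> \<bar>\<eta> \<omega>\<bar> \<le> c"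
  shows "ito_limit s i (\<lambda>p. \<eta> (snd p) *\<^sub>R X p) (\<lambda>\<omega>. \<eta> \<omega> *\<^sub>R S \<omega>)"
proof (rule ito_limit_map_coeff[OF X, where h = "\<lambda>\<omega> x. \<eta> \<omega> *\<^sub>R x" and c = "\<bar>c\<bar>"])
  have \<eta>P: "\<eta> \<in> borel_measurable P" by (rule measurable_of_F[OF s \<eta>])
  show "linear (\<lambda>x. \<eta> \<omega> *\<^sub>R x)" for \<omega> by (rule linear_scaleR)
  show "(\<lambda>\<omega>. \<eta> \<omega> *\<^sub>R \<xi> \<omega>) \<in> borel_measurable (F a)"
    if "s \<le> a" "\<xi> \<in> borel_measurable (F a)" for a and \<xi> :: "'w \<Rightarrow> 'b"
    by (intro borel_measurable_scaleR that(2) measurable_F_mono[OF \<eta> s that(1)])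
  show "norm (\<eta> \<omega> *\<^sub>R x) \<le> \<bar>c\<bar> * norm x" if "\<omega> \<in> space P" for \<omega> x
    using c[OF that] by (auto intro!: mult_right_mono)
  show "l2_tendsto LP (\<lambda>n p. \<eta> (snd p) *\<^sub>R Z n p) (\<lambda>p. \<eta> (snd p) *\<^sub>R X p)" if "l2_tendsto LP Z X" for Z
    by (rule l2_tendsto_scaleR_bounded[OF that measurable_snd_P[OF \<eta>P], of c])
      (auto simp: space_pair_measure c)
  show "l2_tendsto P (\<lambda>n \<omega>. \<eta> \<omega> *\<^sub>R Z n \<omega>) (\<lambda>\<omega>. \<eta> \<omega> *\<^sub>R S \<omega>)" if "l2_tendsto P Z S" for Z
    by (rule l2_tendsto_scaleR_bounded[OF that \<eta>P c])
qed simp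

lemma ito_limit_diff:
  assumes X: "ito_limit s i X S" and Y: "ito_limit s i Y T"
  shows "ito_limit s i (\<lambda>p. X p - Y p) (\<lambda>\<omega>. S \<omega> - T \<omega>)"
proof -
  obtain L where L: "\<And>n. adapted_list s (L n)" "l2_tendsto LP (\<lambda>n. elem_val (L n)) X"
    "l2_tendsto P (\<lambda>n. elem_int i (L n)) S" using X by (rule ito_limitE) blast
  have "ito_limit s i (\<lambda>p. - Y p) (\<lambda>\<omega>. - T \<omega>)"
    by (rule ito_limit_linear[OF Y bounded_linear_minus[OF bounded_linear_ident]])
  then obtain L' where L': "\<And>n. adapted_list s (L' n)" "l2_tendsto LP (\<lambda>n. elem_val (L' n)) (\<lambda>p. - Y p)"
    "l2_tendsto P (\<lambda>n. elem_int i (L' n)) (\<lambda>\<omega>. - T \<omega>)" by (rule ito_limitE) blast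
  have "l2_tendsto LP (\<lambda>n. elem_val (L n @ L' n)) (\<lambda>p. X p - Y p)"
    using l2_tendsto_add[OF L(2) L'(2)] by (simp add: elem_val_append[abs_def])
  moreover have "l2_tendsto P (\<lambda>n. elem_int i (L n @ L' n)) (\<lambda>\<omega>. S \<omega> - T \<omega>)"
    using l2_tendsto_add[OF L(3) L'(3)] by (simp add: elem_int_append[abs_def])
  ultimately show ?thesis
    unfolding ito_limit_def using L(1) L'(1)
    by (intro exI[of _ "\<lambda>n. L n @ L' n"]) (simp add: adapted_list_append)
qed

text \<open>The integrand vanishes up to time \<open>r\<close>, its elementary approximations need not. Their parts up to
  \<open>r\<close> tend to zero in \<open>L\<^sup>2\<close>, hence by the isometry so do the integrals of these parts, and the
  remaining integrals are orthogonal to the past at \<open>r\<close>.\<close>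

lemma expectation_past_inner_ito:
  fixes X :: "real \<times> 'w \<Rightarrow> 'b::euclidean_space"
  assumes s: "0 \<le> s" "s \<le> r" and X: "ito_limit s i X S"
    and X0: "AE p in LP. fst p \<le> r \<longrightarrow> X p = 0"
    and \<eta>: "\<eta> \<in> borel_measurable (F r)" "square_integrable P \<eta>"
  shows "expectation (\<lambda>\<omega>. \<eta> \<omega> \<bullet> S \<omega>) = 0"
proof -
  obtain L where L: "\<And>n. adapted_list s (L n)" "l2_tendsto LP (\<lambda>n. elem_val (L n)) X"
    "l2_tendsto P (\<lambda>n. elem_int i (L n)) S" using X by (rule ito_limitE) blast
  have r: "0 \<le> r" using s by simp
  define L' where "L' n = after_time r (L n)" for n
  define D where "D n = L n @ map_coeff (\<lambda>_ x. - x) (L' n)" for n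
  have neg: "linear (\<lambda>x::'b. - x)" by (rule linear_uminus)
  have L'r: "adapted_list r (L' n)" for n
    using adapted_list_after_time[OF L(1) s(1), of r n] s by (simp add: L'_def max_absorb2)
  have L's: "adapted_list s (L' n)" for n
    by (rule adapted_list_mono[OF L'r s(2)])
  have "adapted_list s (map_coeff (\<lambda>_ x. - x) (L' n))" for n
    by (rule adapted_list_map_coeff[OF L's, where c = 1]) auto
  then have D: "adapted_list s (D n)" for n using L(1) by (simp add: D_def adapted_list_append)
  have Dval: "elem_val (D n) = (\<lambda>p. elem_val (L n) p - elem_val (L' n) p)" for n
    by (simp add: D_def elem_val_append elem_val_map_coeff[OF neg] fun_eq_iff)
  have Dint: "elem_int i (D n) = (\<lambda>\<omega>. elem_int i (L n) \<omega> - elem_int i (L' n) \<omega>)" for n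
    by (simp add: D_def elem_int_append elem_int_map_coeff[OF neg] fun_eq_iff)
  have D0: "l2_tendsto LP (\<lambda>n. elem_val (D n)) (\<lambda>p. 0)"
  proof (rule l2_tendsto_dominated[OF L(2), where c = 1])
    show "AE p in LP. (norm (elem_val (D n) p - 0))\<^sup>2 \<le> 1 * (norm (elem_val (L n) p - X p))\<^sup>2" for n
      using X0 by eventually_elim (auto simp: Dval L'_def elem_val_after_time indicator_def)
  qed (auto intro: square_integrable_elem_val[OF s(1) D] square_integrable_zero)
  have "(\<lambda>n. expectation (\<lambda>\<omega>. elem_int i (D n) \<omega> \<bullet> elem_int i (D n) \<omega>))
      \<longlonglongrightarrow> K $ i $ i * (LINT p|LP. (0::'b) \<bullet> 0)"
    unfolding elem_isometry[OF s(1) D D] by (intro tendsto_mult_left l2_tendsto_inner D0)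
  then have I0: "l2_tendsto P (\<lambda>n. elem_int i (D n)) (\<lambda>\<omega>. 0)"
    by (simp add: l2_tendsto_def square_integrable_elem_int[OF s(1) D] square_integrable_zero
        power2_norm_eq_inner)
  have "(\<lambda>n. expectation (\<lambda>\<omega>. \<eta> \<omega> \<bullet> elem_int i (D n) \<omega>)) \<longlonglongrightarrow> expectation (\<lambda>\<omega>. \<eta> \<omega> \<bullet> 0)"
    by (intro l2_tendsto_inner l2_tendsto_const \<eta>(2) I0)
  moreover have "expectation (\<lambda>\<omega>. \<eta> \<omega> \<bullet> elem_int i (D n) \<omega>) =
      expectation (\<lambda>\<omega>. \<eta> \<omega> \<bullet> elem_int i (L n) \<omega>)" for n
    unfolding Dint inner_diff_right
    using expectation_past_inner_elem_int[OF r L'r \<eta>, of i n]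
      integrable_inner[OF \<eta>(2) square_integrable_elem_int[OF s(1) L(1)], of i n]
      integrable_inner[OF \<eta>(2) square_integrable_elem_int[OF r L'r], of i n]
    by simp
  ultimately have "(\<lambda>n. expectation (\<lambda>\<omega>. \<eta> \<omega> \<bullet> elem_int i (L n) \<omega>)) \<longlonglongrightarrow> 0" by simp
  moreover have "(\<lambda>n. expectation (\<lambda>\<omega>. \<eta> \<omega> \<bullet> elem_int i (L n) \<omega>)) \<longlonglongrightarrow> expectation (\<lambda>\<omega>. \<eta> \<omega> \<bullet> S \<omega>)"
    by (intro l2_tendsto_inner l2_tendsto_const \<eta>(2) L(3))
  ultimately show ?thesis by (metis LIMSEQ_unique)
qed

text \<open>Sending the times outside \<open>J\<close> to one point of \<open>J\<close> reduces measurability on \<open>\<real> \<times> \<Omega>\<close> to measurability on \<open>J \<times> \<Omega>\<close>.\<close>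

lemma adapted_measurable_cutoff:
  assumes X: "adapted_measurable P F J X" and J: "J \<in> sets borel" "t0 \<in> J"
  shows "(\<lambda>p. indicator J (fst p) *\<^sub>R X (fst p) (snd p)) \<in> borel_measurable LP"
proof -
  let ?c = "\<lambda>r. if r \<in> J then r else t0"
  have "?c \<in> measurable borel (restrict_space borel J)"
    using J by (intro measurable_restrict_space2) auto
  then have "(\<lambda>p. (?c (fst p), snd p)) \<in> measurable LP (restrict_space borel J \<Otimes>\<^sub>M P)"
    by measurable
  moreover have "(\<lambda>(t, \<omega>). X t \<omega>) \<in> borel_measurable (restrict_space borel J \<Otimes>\<^sub>M P)"
    using X by (simp add: adapted_measurable_def)
  ultimately have "(\<lambda>p. (\<lambda>(t, \<omega>). X t \<omega>) (?c (fst p), snd p)) \<in> borel_measurable LP"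
    by (rule measurable_compose)
  then have Xc: "(\<lambda>p. X (?c (fst p)) (snd p)) \<in> borel_measurable LP" by (simp add: case_prod_beta')
  have "(\<lambda>p. indicator J (fst p) :: real) \<in> borel_measurable LP"
    using J(1) by (intro measurable_compose[OF measurable_fst borel_measurable_indicator]) simp
  then have "(\<lambda>p. indicator J (fst p) *\<^sub>R X (?c (fst p)) (snd p)) \<in> borel_measurable LP"
    by (rule borel_measurable_scaleR[OF _ Xc])
  also have "(\<lambda>p. indicator J (fst p) *\<^sub>R X (?c (fst p)) (snd p)) =
      (\<lambda>p. indicator J (fst p) *\<^sub>R X (fst p) (snd p))"
    by (auto simp: indicator_def)
  finally show ?thesis .
qed

lemma partition_bounds:
  assumes sp: "simple_process P F s t m \<tau> \<xi>" and j: "j \<le> m"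
  shows "s \<le> \<tau> j" "\<tau> j \<le> t"
proof -
  have inc: "\<And>j. j < m \<Longrightarrow> \<tau> j \<le> \<tau> (Suc j)" and e: "\<tau> 0 = s" "\<tau> m = t"
    using sp by (auto simp: simple_process_def)
  show "s \<le> \<tau> j"
    using j
  proof (induction j)
    case (Suc j)
    then show ?case using inc[of j] by simp
  qed (simp add: e)
  show "\<tau> j \<le> t"
    using j
  proof (induction j rule: inc_induct)
    case (step n)
    then show ?case using inc[of n] by simp
  qed (simp add: e)
qed

text \<open>The cells of a partition form the list of intervals. A simple process on \<open>[s,t]\<close> vanishes outside
  that interval, so both notions of convergence of the integrands agree.\<close>

lemma ito_limit_of_has_ito_integral:
  fixes f :: "real \<Rightarrow> 'w \<Rightarrow> 'b::euclidean_space"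
  assumes s: "0 \<le> s" and I: "has_ito_integral P F (\<lambda>r \<omega>. w r \<omega> $ i) s t f I"
  shows "ito_limit s i (\<lambda>p. indicator {s..t} (fst p) *\<^sub>R f (fst p) (snd p)) I"
proof -
  let ?f = "\<lambda>p. indicator {s..t} (fst p) *\<^sub>R f (fst p) (snd p)"
  obtain m \<tau> \<xi> where sp: "\<And>k. simple_process P F s t (m k) (\<tau> k) (\<xi> k)"
    and lf: "(\<lambda>k. \<integral>\<^sup>+\<omega>. (\<integral>\<^sup>+r\<in>{s..t}.
          ennreal ((norm (f r \<omega> - simple_value (m k) (\<tau> k) (\<xi> k) r \<omega>))\<^sup>2) \<partial>lborel) \<partial>P) \<longlonglongrightarrow> 0"
    and lI: "(\<lambda>k. \<integral>\<^sup>+\<omega>. ennreal ((norm (simple_integral_wrt (\<lambda>r \<omega>. w r \<omega> $ i) (m k) (\<tau> k) (\<xi> k) \<omega> - I \<omega>))\<^sup>2) \<partial>P)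
        \<longlonglongrightarrow> 0"
    and f: "adapted_measurable P F {s..t} f" and Im: "I \<in> borel_measurable P"
    using I unfolding has_ito_integral_def by blast
  define L where "L k = map (\<lambda>j. (\<tau> k j, \<tau> k (Suc j), \<xi> k j)) [0..<m k]" for k
  have L: "adapted_list s (L k)" for k
    using sp[of k] partition_bounds(1)[OF sp, of _ k]
    by (auto simp: adapted_list_def L_def simple_process_def)
  have val: "elem_val (L k) p = simple_value (m k) (\<tau> k) (\<xi> k) (fst p) (snd p)" for k p
    by (simp add: L_def elem_val_def simple_value_def o_def interv_sum_list_conv_sum_set_nat
        atLeast0LessThan)
  have int: "elem_int i (L k) = simple_integral_wrt (\<lambda>r \<omega>. w r \<omega> $ i) (m k) (\<tau> k) (\<xi> k)" for k
    by (simp add: L_def elem_int_def simple_integral_wrt_def incr_def o_def fun_eq_iff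
        interv_sum_list_conv_sum_set_nat atLeast0LessThan)
  have st: "s \<le> t" using partition_bounds[OF sp, of 0 0] by simp
  have fm: "?f \<in> borel_measurable LP"
    using st by (intro adapted_measurable_cutoff[OF f, of s]) auto
  have vm: "elem_val (L k) \<in> borel_measurable LP" for k
    by (rule square_integrable_measurable[OF square_integrable_elem_val[OF s L]])
  have out: "simple_value (m k) (\<tau> k) (\<xi> k) r \<omega> = 0" if "r \<notin> {s..t}" for k r \<omega>
    unfolding simple_value_def
  proof (intro sum.neutral ballI)
    fix j assume "j \<in> {..<m k}"
    then have "r \<notin> {\<tau> k j<..\<tau> k (Suc j)}"
      using that partition_bounds[OF sp, of j k] partition_bounds[OF sp, of "Suc j" k] by auto
    then show "indicator {\<tau> k j<..\<tau> k (Suc j)} r *\<^sub>R \<xi> k j \<omega> = 0" by simp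
  qed
  have "(\<integral>\<^sup>+p. ennreal ((norm (elem_val (L k) p - ?f p))\<^sup>2) \<partial>LP) =
      (\<integral>\<^sup>+\<omega>. (\<integral>\<^sup>+r\<in>{s..t}.
          ennreal ((norm (f r \<omega> - simple_value (m k) (\<tau> k) (\<xi> k) r \<omega>))\<^sup>2) \<partial>lborel) \<partial>P)" for k
  proof -
    have "(\<integral>\<^sup>+p. ennreal ((norm (elem_val (L k) p - ?f p))\<^sup>2) \<partial>LP) =
        (\<integral>\<^sup>+\<omega>. (\<integral>\<^sup>+r. ennreal ((norm (elem_val (L k) (r, \<omega>) - ?f (r, \<omega>)))\<^sup>2) \<partial>lborel) \<partial>P)"
      using LP.nn_integral_snd[of "\<lambda>p. ennreal ((norm (elem_val (L k) p - ?f p))\<^sup>2)"] fm vm by simp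
    also have "\<dots> = (\<integral>\<^sup>+\<omega>. (\<integral>\<^sup>+r\<in>{s..t}.
          ennreal ((norm (f r \<omega> - simple_value (m k) (\<tau> k) (\<xi> k) r \<omega>))\<^sup>2) \<partial>lborel) \<partial>P)"
      by (intro nn_integral_cong) (auto simp: val out indicator_def norm_minus_commute)
    finally show ?thesis .
  qed
  with lf have "(\<lambda>k. \<integral>\<^sup>+p. ennreal ((norm (elem_val (L k) p - ?f p))\<^sup>2) \<partial>LP) \<longlonglongrightarrow> 0" by simp
  from l2_tendsto_of_nn_integral[OF square_integrable_elem_val[OF s L] fm this]
  obtain d where d: "\<And>e. e \<ge> d \<Longrightarrow> l2_tendsto LP (\<lambda>n. elem_val (L (n + e))) ?f" by blast
  from l2_tendsto_of_nn_integral[OF square_integrable_elem_int[OF s L] Im lI[folded int]]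
  obtain d' where d': "\<And>e. e \<ge> d' \<Longrightarrow> l2_tendsto P (\<lambda>n. elem_int i (L (n + e))) I" by blast
  from d[of "max d d'"] d'[of "max d d'"] L show ?thesis
    unfolding ito_limit_def by (intro exI[of _ "\<lambda>n. L (n + max d d')"]) simp
qed

end

section \<open>The mean of a quadratic form along a linear stochastic equation\<close>

lemma inner_matrix_transpose:
  fixes Q :: "real^'n^'m"
  shows "x \<bullet> (Q *v y) = (transpose Q *v x) \<bullet> y"
  by (simp add: dot_lmul_matrix transpose_matrix_vector)

lemma inner_symmetric_matrix:
  fixes Q :: "real^'n^'n"
  assumes "transpose Q = Q"
  shows "x \<bullet> (Q *v y) = y \<bullet> (Q *v x)"
  using inner_matrix_transpose[of x Q y] assms by (simp add: inner_commute)

lemma lyapunov_op_quadratic_form: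
  fixes A :: "real^'n^'n" and N :: "'q::finite \<Rightarrow> real^'n^'n" and K :: "real^'q^'q"
  assumes Q: "transpose Q = Q"
  shows "v \<bullet> (lyapunov_op A N K Q *v v) = 2 * (v \<bullet> (Q *v (A *v v)))
    + (\<Sum>i\<in>UNIV. \<Sum>j\<in>UNIV. K $ i $ j * ((N i *v v) \<bullet> (Q *v (N j *v v))))"
proof -
  have sum: "(\<Sum>i\<in>I. f i) *v v = (\<Sum>i\<in>I. f i *v v)" for I and f :: "'q \<Rightarrow> real^'n^'n"
    by (induction I rule: infinite_finite_induct) (auto simp: matrix_vector_mult_add_rdistrib)
  have "v \<bullet> ((transpose A ** Q) *v v) = v \<bullet> (Q *v (A *v v))"
    using inner_matrix_transpose[of v "transpose A" "Q *v v"] inner_symmetric_matrix[OF Q, of "A *v v" v]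
    by (simp add: matrix_vector_mul_assoc[symmetric])
  moreover have "v \<bullet> ((transpose (N i) ** Q ** N j) *v v) = (N i *v v) \<bullet> (Q *v (N j *v v))" for i j
    using inner_matrix_transpose[of v "transpose (N i)" "Q *v (N j *v v)"]
    by (simp add: matrix_vector_mul_assoc[symmetric])
  ultimately show ?thesis
    by (simp add: lyapunov_op_def matrix_vector_mult_add_rdistrib inner_add_right sum inner_sum_right
        scaleR_matrix_vector_assoc[symmetric] matrix_vector_mul_assoc[symmetric])
qed

text \<open>The antiderivative \<open>y\<close> of the continuous function \<open>f\<close> is differentiable, and symmetry of \<open>Q\<close> makes
  \<open>2 \<langle>y, Q f\<rangle>\<close> the derivative of \<open>\<langle>y, Q y\<rangle>\<close>.\<close>

lemma quadratic_form_of_integral: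
  fixes f :: "real \<Rightarrow> real^'n" and Q :: "real^'n^'n"
  assumes ab: "a \<le> b" and f: "continuous_on {a..b} f" and Q: "transpose Q = Q"
    and y: "\<And>r. r \<in> {a..b} \<Longrightarrow> y r = c + (LINT s:{a..r}|lborel. f s)"
  shows "(LINT r:{a..b}|lborel. 2 * (y r \<bullet> (Q *v f r))) = y b \<bullet> (Q *v y b) - c \<bullet> (Q *v c)"
proof -
  have y': "y r = c + integral {a..r} f" if "r \<in> {a..b}" for r
  proof -
    have "set_integrable lborel {a..r} f"
      using that by (intro borel_integrable_atLeastAtMost' continuous_on_subset[OF f]) auto
    then show ?thesis using y[OF that] by (simp add: set_borel_integral_eq_integral)
  qed
  have dy: "(y has_vector_derivative f r) (at r within {a..b})" if "r \<in> {a..b}" for r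
  proof -
    have "((\<lambda>r. c + integral {a..r} f) has_vector_derivative f r) (at r within {a..b})"
      using integral_has_vector_derivative[OF f that] by (auto intro!: derivative_eq_intros)
    then show ?thesis using that y' by (rule has_vector_derivative_transform[rotated -1])
  qed
  have cy: "continuous_on {a..b} y"
    unfolding continuous_on_eq_continuous_within
    by (intro ballI has_vector_derivative_continuous[OF dy])
  have bl: "bounded_linear ((*v) Q)" by (rule matrix_vector_mul_bounded_linear)
  have dq: "((\<lambda>r. y r \<bullet> (Q *v y r)) has_vector_derivative 2 * (y r \<bullet> (Q *v f r))) (at r within {a..b})"
    if "r \<in> {a..b}" for r
    using bounded_bilinear.has_vector_derivative[OF bounded_bilinear_inner dy[OF that]
        bounded_linear.has_vector_derivative[OF bl dy[OF that]]]
      inner_symmetric_matrix[OF Q, of "f r" "y r"] by simp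
  have "((\<lambda>r. 2 * (y r \<bullet> (Q *v f r))) has_integral y b \<bullet> (Q *v y b) - y a \<bullet> (Q *v y a)) {a..b}"
    by (rule fundamental_theorem_of_calculus[OF ab dq])
  then have "integral {a..b} (\<lambda>r. 2 * (y r \<bullet> (Q *v f r))) = y b \<bullet> (Q *v y b) - y a \<bullet> (Q *v y a)"
    by (rule integral_unique)
  moreover have int: "set_integrable lborel {a..b} (\<lambda>r. 2 * (y r \<bullet> (Q *v f r)))"
    by (intro borel_integrable_atLeastAtMost' continuous_intros cy
        bounded_linear.continuous_on[OF bl] f)
  moreover have "y a = c" using y'[of a] ab by simp
  ultimately show ?thesis using set_borel_integral_eq_integral(2)[OF int] by simp
qed

context wiener_setting
begin

lemma AE_LP_snd:
  assumes "AE \<omega> in P. \<phi> \<omega>"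
  shows "AE p in LP. \<phi> (snd p)"
proof -
  obtain N where N: "{\<omega> \<in> space P. \<not> \<phi> \<omega>} \<subseteq> N" "N \<in> null_sets P"
    using assms by (auto elim!: AE_E simp: null_sets_def)
  have "UNIV \<times> N \<in> null_sets LP"
    using N(2) by (auto simp: null_sets_def emeasure_pair_measure_Times)
  then show ?thesis
    by (rule AE_I') (use N(1) in \<open>auto simp: space_pair_measure\<close>)
qed

lemma AE_LP_fst_neq: "AE p in LP. fst p \<noteq> r"
proof -
  have "{r} \<times> space P \<in> null_sets LP"
    by (auto simp: null_sets_def emeasure_pair_measure_Times)
  then show ?thesis by (rule AE_I') (auto simp: space_pair_measure)
qed

lemma square_integrable_process:
  assumes t0: "0 \<le> t0" and v: "L2_adapted P F t0 v"
  shows "square_integrable LP (\<lambda>p. indicator {t0..T} (fst p) *\<^sub>R v (fst p) (snd p))"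
proof -
  let ?V = "\<lambda>p. indicator {t0..T} (fst p) *\<^sub>R v (fst p) (snd p)"
  have "(\<lambda>p. indicator {t0..} (fst p) *\<^sub>R v (fst p) (snd p)) \<in> borel_measurable LP"
    using v by (intro adapted_measurable_cutoff[of _ _ t0]) (auto simp: L2_adapted_def)
  then have "(\<lambda>p. indicator {t0..T} (fst p) *\<^sub>R indicator {t0..} (fst p) *\<^sub>R v (fst p) (snd p)) \<in> borel_measurable LP"
    by measurable
  also have "(\<lambda>p. indicator {t0..T} (fst p) *\<^sub>R indicator {t0..} (fst p) *\<^sub>R v (fst p) (snd p)) = ?V"
    by (auto simp: indicator_def fun_eq_iff)
  finally have m: "?V \<in> borel_measurable LP" .
  have m2: "(\<lambda>p. (norm (?V p))\<^sup>2) \<in> borel_measurable LP"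
    by (intro borel_measurable_power measurable_compose[OF m borel_measurable_norm])
  have "(\<integral>\<^sup>+p. ennreal ((norm (?V p))\<^sup>2) \<partial>LP) =
      (\<integral>\<^sup>+\<omega>. (\<integral>\<^sup>+r. ennreal ((norm (?V (r, \<omega>)))\<^sup>2) \<partial>lborel) \<partial>P)"
    by (rule LP.nn_integral_snd[OF measurable_compose[OF m2 measurable_ennreal], symmetric])
  also have "\<dots> \<le> (\<integral>\<^sup>+\<omega>. (\<integral>\<^sup>+r\<in>{t0..max T (t0 + 1)}. ennreal ((norm (v r \<omega>))\<^sup>2) \<partial>lborel) \<partial>P)"
    by (intro nn_integral_mono) (auto simp: indicator_def)
  also have "\<dots> < \<infinity>" using v by (auto simp: L2_adapted_def less_max_iff_disj)
  finally have "integrable LP (\<lambda>p. (norm (?V p))\<^sup>2)"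
    by (intro integrableI_bounded m2) simp
  with m show ?thesis by (simp add: square_integrable_def)
qed

text \<open>This is Ito's formula for a quadratic form, after taking means. Split \<open>v = y + M\<close> into the
  absolutely continuous part \<open>y = v0 + \<integral> A v\<close> and the martingale part \<open>M\<close>, and expand.\<close>

lemma expectation_quadratic_form:
  fixes v :: "real \<Rightarrow> 'w \<Rightarrow> real^'n" and A Q :: "real^'n^'n" and N :: "'q \<Rightarrow> real^'n^'n"
  assumes t0: "0 \<le> t0" and T: "t0 \<le> T" and Q: "transpose Q = Q"
    and vF: "\<And>t. t0 \<le> t \<Longrightarrow> v t \<in> borel_measurable (F t)"
    and v_sq: "square_integrable LP (\<lambda>p. indicator {t0..T} (fst p) *\<^sub>R v (fst p) (snd p))"
    and cont: "AE \<omega> in P. continuous_on {t0..} (\<lambda>t. v t \<omega>)"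
    and v0: "v0 \<in> borel_measurable (F t0)" "square_integrable P v0"
    and eq: "\<And>t. t0 \<le> t \<Longrightarrow> \<exists>I.
      (\<forall>i. ito_limit t0 i (\<lambda>p. indicator {t0..t} (fst p) *\<^sub>R (N i *v v (fst p) (snd p))) (I i)) \<and>
      (AE \<omega> in P. v t \<omega> = v0 \<omega> + (LINT r:{t0..t}|lborel. A *v v r \<omega>) + (\<Sum>i\<in>UNIV. I i \<omega>))"
  defines "V \<equiv> \<lambda>p. indicator {t0..T} (fst p) *\<^sub>R v (fst p) (snd p)"
  shows "expectation (\<lambda>\<omega>. v T \<omega> \<bullet> (Q *v v T \<omega>)) = expectation (\<lambda>\<omega>. v0 \<omega> \<bullet> (Q *v v0 \<omega>))
      + (LINT p|LP. V p \<bullet> (lyapunov_op A N K Q *v V p))"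
proof -
  define J where "J = {t0..T}"
  have blQ: "bounded_linear ((*v) Q)" and blA: "bounded_linear ((*v) A)"
    and blN: "bounded_linear ((*v) (N i))" for i
    by (rule matrix_vector_mul_bounded_linear)+
  have V: "square_integrable LP V" unfolding V_def by (rule v_sq)
  have AV: "square_integrable LP (\<lambda>p. A *v V p)" by (rule square_integrable_linear[OF V blA])
  have AVm: "(\<lambda>p. A *v V p) \<in> borel_measurable LP" by (rule square_integrable_measurable[OF AV])
  have NV: "square_integrable LP (\<lambda>p. N i *v V p)" for i by (rule square_integrable_linear[OF V blN])
  have VJ: "V (r, \<omega>) = v r \<omega>" if "r \<in> J" for r \<omega> using that by (simp add: V_def J_def)

  \<comment> \<open>The cut-off integrand \<open>V\<close> in place of \<open>v\<close> makes \<open>D\<close> jointly measurable on all of \<open>\<real> \<times> \<Omega>\<close>.\<close>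
  define D where "D r \<omega> = (LINT s|lborel. indicator {t0..r} s *\<^sub>R (A *v V (s, \<omega>)))" for r \<omega>
  define y where "y r \<omega> = v0 \<omega> + D r \<omega>" for r \<omega>
  define G where "G \<omega> = (T - t0) * (LINT s|lborel. (norm (A *v V (s, \<omega>)))\<^sup>2)" for \<omega>
  have D_set: "D r \<omega> = (LINT s:{t0..r}|lborel. A *v v s \<omega>)" if "r \<in> J" for r \<omega>
    unfolding D_def set_lebesgue_integral_def using that
    by (intro Bochner_Integration.integral_cong) (auto simp: V_def J_def indicator_def)
  have Dm: "(\<lambda>p. D (fst p) (snd p)) \<in> borel_measurable LP"
  proof -
    have "(\<lambda>(p, s). indicator {t0..fst p} s *\<^sub>R (A *v V (s, snd p))) \<in> borel_measurable (LP \<Otimes>\<^sub>M lborel)"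
    proof -
      have "(\<lambda>x. (snd x, snd (fst x))) \<in> measurable (LP \<Otimes>\<^sub>M lborel) LP" by measurable
      from measurable_compose[OF this AVm]
      have 1: "(\<lambda>x. A *v V (snd x, snd (fst x))) \<in> borel_measurable (LP \<Otimes>\<^sub>M lborel)" .
      have 2: "(\<lambda>x. if t0 \<le> snd x \<and> snd x \<le> fst (fst x) then 1 else 0 :: real)
          \<in> borel_measurable (LP \<Otimes>\<^sub>M lborel)" by measurable
      have "(\<lambda>(p, s). indicator {t0..fst p} s *\<^sub>R (A *v V (s, snd p))) =
          (\<lambda>x. (if t0 \<le> snd x \<and> snd x \<le> fst (fst x) then 1 else 0 :: real)
            *\<^sub>R (A *v V (snd x, snd (fst x))))"
        by (auto simp: fun_eq_iff indicator_def)
      then show ?thesis using borel_measurable_scaleR[OF 2 1] by simp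
    qed
    then show ?thesis
      unfolding D_def by (rule lborel.borel_measurable_lebesgue_integral)
  qed
  have Drm: "D r \<in> borel_measurable P" for r
    using measurable_compose[OF measurable_Pair1' Dm, of r] by simp
  have AVn: "integrable LP (\<lambda>(s, \<omega>). (norm (A *v V (s, \<omega>)))\<^sup>2)"
    using square_integrable_norm[OF AV] by (simp add: case_prod_beta')
  have AVsec: "AE \<omega> in P. square_integrable lborel (\<lambda>s. A *v V (s, \<omega>))"
  proof -
    have "AE \<omega> in P. integrable lborel (\<lambda>s. (norm (A *v V (s, \<omega>)))\<^sup>2)"
      by (rule LP.AE_integrable_snd[OF AVn])
    then show ?thesis
    proof (rule AE_mp, intro AE_I2 impI)
      fix \<omega> assume "\<omega> \<in> space P" "integrable lborel (\<lambda>s. (norm (A *v V (s, \<omega>)))\<^sup>2)"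
      then show "square_integrable lborel (\<lambda>s. A *v V (s, \<omega>))"
        using measurable_compose[OF measurable_Pair2' AVm, of \<omega>]
        by (simp add: square_integrable_def)
    qed
  qed
  have Gint: "integrable P G"
    unfolding G_def by (intro integrable_mult_right LP.integrable_snd[OF AVn])
  have DG: "AE \<omega> in P. \<forall>r\<in>J. (norm (D r \<omega>))\<^sup>2 \<le> G \<omega>"
    using AVsec
  proof (rule AE_mp, intro AE_I2 impI ballI)
    fix \<omega> r assume S: "square_integrable lborel (\<lambda>s. A *v V (s, \<omega>))" and r: "r \<in> J"
    have c1: "square_integrable lborel (indicator {t0..r} :: real \<Rightarrow> real)"
      using integrable_real_indicator[of "{t0..r}" lborel]
      by (simp add: square_integrable_def power2_eq_square emeasure_lborel_Icc_eq
          flip: indicator_inter_arith)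
    have c2: "square_integrable lborel (\<lambda>s. norm (A *v V (s, \<omega>)))"
      using S measurable_compose[OF square_integrable_measurable[OF S] borel_measurable_norm]
      by (simp add: square_integrable_def)
    have l: "(LINT s|lborel. (norm (indicator {t0..r} s :: real))\<^sup>2) = r - t0"
      using r by (simp add: power2_eq_square J_def flip: indicator_inter_arith)
    \<comment> \<open>Cauchy--Schwarz against the indicator of the interval.\<close>
    have "norm (D r \<omega>) \<le> (LINT s|lborel. norm (indicator {t0..r} s *\<^sub>R (A *v V (s, \<omega>))))"
      unfolding D_def by (rule integral_norm_bound)
    also have "\<dots> = (LINT s|lborel. indicator {t0..r} s \<bullet> norm (A *v V (s, \<omega>)))" by simp
    also have "\<dots> \<le> sqrt (r - t0) * sqrt (LINT s|lborel. (norm (norm (A *v V (s, \<omega>))))\<^sup>2)"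
      using integral_Cauchy_Schwarz[OF c1 c2] unfolding l by linarith
    finally have "(norm (D r \<omega>))\<^sup>2 \<le> (sqrt (r - t0) * sqrt (LINT s|lborel. (norm (A *v V (s, \<omega>)))\<^sup>2))\<^sup>2"
      by (intro power_mono) simp_all
    also have "\<dots> = (r - t0) * (LINT s|lborel. (norm (A *v V (s, \<omega>)))\<^sup>2)"
      using r by (simp add: power_mult_distrib J_def)
    also have "\<dots> \<le> G \<omega>"
      unfolding G_def using r by (intro mult_right_mono) (auto simp: J_def)
    finally show "(norm (D r \<omega>))\<^sup>2 \<le> G \<omega>" .
  qed
  have Dr: "square_integrable P (D r)" if "r \<in> J" for r
    by (rule square_integrable_bound[OF Drm Gint]) (use DG that in auto)
  have yr: "square_integrable P (y r)" if "r \<in> J" for r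
    unfolding y_def by (rule square_integrable_add[OF v0(2) Dr[OF that]])
  define Y where "Y p = indicator J (fst p) *\<^sub>R y (fst p) (snd p)" for p
  have Y: "square_integrable LP Y"
  proof (rule square_integrable_bound[where
        h = "\<lambda>p. indicator J (fst p) * (2 * (norm (v0 (snd p)))\<^sup>2 + 2 * G (snd p))"])
    have "(\<lambda>p. y (fst p) (snd p)) \<in> borel_measurable LP"
      unfolding y_def
      by (intro borel_measurable_add Dm measurable_snd_P square_integrable_measurable[OF v0(2)])
    then show "Y \<in> borel_measurable LP" unfolding Y_def J_def by measurable
    show "integrable LP (\<lambda>p. indicator J (fst p) * (2 * (norm (v0 (snd p)))\<^sup>2 + 2 * G (snd p)))"
      using square_integrable_norm[OF v0(2)] Gint
      by (intro integrable_LP_interval(1)) (auto simp: J_def emeasure_lborel_Icc_eq)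
    show "AE p in LP. (norm (Y p))\<^sup>2 \<le> indicator J (fst p) * (2 * (norm (v0 (snd p)))\<^sup>2 + 2 * G (snd p))"
      using AE_LP_snd[OF DG]
    proof eventually_elim
      case (elim p)
      show ?case
      proof (cases "fst p \<in> J")
        case True
        with elim norm_add_square_le[of "v0 (snd p)" "D (fst p) (snd p)"]
        show ?thesis by (auto simp: Y_def y_def)
      qed (simp add: Y_def)
    qed
  qed

  \<comment> \<open>The equation provides Ito integrals for each end point separately; \<open>M\<close> needs them as one family.\<close>
  have "\<forall>t. \<exists>I. t0 \<le> t \<longrightarrow>
      (\<forall>i. ito_limit t0 i (\<lambda>p. indicator {t0..t} (fst p) *\<^sub>R (N i *v v (fst p) (snd p))) (I i)) \<and>
      (AE \<omega> in P. v t \<omega> = v0 \<omega> + (LINT r:{t0..t}|lborel. A *v v r \<omega>) + (\<Sum>i\<in>UNIV. I i \<omega>))"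
    using eq by blast
  from choice[OF this] obtain I where I: "\<And>t i. t0 \<le> t \<Longrightarrow>
      ito_limit t0 i (\<lambda>p. indicator {t0..t} (fst p) *\<^sub>R (N i *v v (fst p) (snd p))) (I t i)"
    and vI: "\<And>t. t0 \<le> t \<Longrightarrow>
      AE \<omega> in P. v t \<omega> = v0 \<omega> + (LINT r:{t0..t}|lborel. A *v v r \<omega>) + (\<Sum>i\<in>UNIV. I t i \<omega>)"
    by blast
  define M where "M t \<omega> = (\<Sum>i\<in>UNIV. I t i \<omega>)" for t \<omega>
  have Isq: "square_integrable P (I t i)" if "t0 \<le> t" for t i
    by (rule ito_limit_square_integrable(2)[OF I[OF that]])
  have Mt: "square_integrable P (M t)" if "t0 \<le> t" for t
    unfolding M_def by (intro square_integrable_sum Isq that)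
  have QM: "square_integrable P (\<lambda>\<omega>. Q *v M T \<omega>)"
    by (rule square_integrable_linear[OF Mt[OF T] blQ])
  have vyM: "AE \<omega> in P. v t \<omega> = y t \<omega> + M t \<omega>" if "t \<in> J" for t
    using vI[of t] that D_set[OF that] by (simp add: y_def M_def J_def)
  have vt: "square_integrable P (v t)" if "t \<in> J" for t
  proof (rule square_integrable_cong_AE)
    show "square_integrable P (\<lambda>\<omega>. y t \<omega> + M t \<omega>)"
      using that by (intro square_integrable_add yr Mt) (auto simp: J_def)
    show "v t \<in> borel_measurable P"
      using that t0 by (intro measurable_of_F[OF _ vF]) (auto simp: J_def)
    show "AE \<omega> in P. y t \<omega> + M t \<omega> = v t \<omega>" using vyM[OF that] by auto
  qed
  have TJ: "T \<in> J" using T by (simp add: J_def)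

  \<comment> \<open>The isometry applies to each pair of summands; \<open>K\<close> enters as their correlation.\<close>
  have qM: "expectation (\<lambda>\<omega>. M T \<omega> \<bullet> (Q *v M T \<omega>)) =
      (LINT p|LP. (\<Sum>i\<in>UNIV. \<Sum>j\<in>UNIV. K $ i $ j * ((N i *v V p) \<bullet> (Q *v (N j *v V p)))))"
  proof -
    have IV: "ito_limit t0 i (\<lambda>p. N i *v V p) (I T i)" for i
      using I[OF T, of i] by (simp add: V_def matrix_vector_mult_scaleR)
    have IQ: "square_integrable P (\<lambda>\<omega>. Q *v I T j \<omega>)" for j
      by (rule square_integrable_linear[OF Isq[OF T] blQ])
    have "expectation (\<lambda>\<omega>. M T \<omega> \<bullet> (Q *v M T \<omega>)) =
        expectation (\<lambda>\<omega>. \<Sum>i\<in>UNIV. \<Sum>j\<in>UNIV. I T i \<omega> \<bullet> (Q *v I T j \<omega>))"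
      unfolding M_def linear_sum[OF bounded_linear.linear[OF blQ]] inner_sum_left
      by (simp only: inner_sum_right)
    also have "\<dots> = (\<Sum>i\<in>UNIV. \<Sum>j\<in>UNIV. expectation (\<lambda>\<omega>. I T i \<omega> \<bullet> (Q *v I T j \<omega>)))"
      by (simp add: integrable_inner[OF Isq[OF T] IQ])
    also have "\<dots> = (\<Sum>i\<in>UNIV. \<Sum>j\<in>UNIV. (LINT p|LP. K $ i $ j * ((N i *v V p) \<bullet> (Q *v (N j *v V p)))))"
      by (simp add: ito_isometry[OF t0 IV ito_limit_linear[OF IV blQ]])
    also have "\<dots> = (LINT p|LP. (\<Sum>i\<in>UNIV. \<Sum>j\<in>UNIV. K $ i $ j * ((N i *v V p) \<bullet> (Q *v (N j *v V p)))))"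
      by (simp add: integrable_inner[OF NV square_integrable_linear[OF NV blQ]])
    finally show ?thesis .
  qed

  have qy: "expectation (\<lambda>\<omega>. y T \<omega> \<bullet> (Q *v y T \<omega>)) = expectation (\<lambda>\<omega>. v0 \<omega> \<bullet> (Q *v v0 \<omega>))
      + 2 * (LINT p|LP. Y p \<bullet> (Q *v (A *v V p)))"
  proof -
    have i1: "integrable LP (\<lambda>p. 2 * (Y p \<bullet> (Q *v (A *v V p))))"
      by (intro integrable_mult_right integrable_inner Y square_integrable_linear[OF AV blQ])
    have i0: "integrable P (\<lambda>\<omega>. v0 \<omega> \<bullet> (Q *v v0 \<omega>))"
      by (intro integrable_inner v0 square_integrable_linear[OF v0(2) blQ])
    have i1': "integrable LP (\<lambda>(r, \<omega>). 2 * (Y (r, \<omega>) \<bullet> (Q *v (A *v V (r, \<omega>)))))"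
      using i1 by (simp add: case_prod_beta')
    have ix: "integrable P (\<lambda>\<omega>. LINT r|lborel. 2 * (Y (r, \<omega>) \<bullet> (Q *v (A *v V (r, \<omega>)))))"
      by (rule LP.integrable_snd[OF i1'])
    have "AE \<omega> in P. y T \<omega> \<bullet> (Q *v y T \<omega>) = v0 \<omega> \<bullet> (Q *v v0 \<omega>)
        + (LINT r|lborel. 2 * (Y (r, \<omega>) \<bullet> (Q *v (A *v V (r, \<omega>)))))"
      using cont
    proof eventually_elim
      case (elim \<omega>)
      have "continuous_on {t0..T} (\<lambda>r. A *v v r \<omega>)"
        by (rule bounded_linear.continuous_on[OF blA continuous_on_subset[OF elim]]) auto
      then have "(LINT r:{t0..T}|lborel. 2 * (y r \<omega> \<bullet> (Q *v (A *v v r \<omega>)))) =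
          y T \<omega> \<bullet> (Q *v y T \<omega>) - v0 \<omega> \<bullet> (Q *v v0 \<omega>)"
        by (rule quadratic_form_of_integral[OF T _ Q]) (simp add: y_def D_set J_def)
      moreover have "(LINT r:{t0..T}|lborel. 2 * (y r \<omega> \<bullet> (Q *v (A *v v r \<omega>)))) =
          (LINT r|lborel. 2 * (Y (r, \<omega>) \<bullet> (Q *v (A *v V (r, \<omega>)))))"
        unfolding set_lebesgue_integral_def
        by (intro Bochner_Integration.integral_cong) (auto simp: V_def Y_def J_def indicator_def)
      ultimately show ?case by simp
    qed
    then have "expectation (\<lambda>\<omega>. y T \<omega> \<bullet> (Q *v y T \<omega>)) = expectation (\<lambda>\<omega>. v0 \<omega> \<bullet> (Q *v v0 \<omega>)
        + (LINT r|lborel. 2 * (Y (r, \<omega>) \<bullet> (Q *v (A *v V (r, \<omega>))))))"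
      using integrable_inner[OF yr[OF TJ] square_integrable_linear[OF yr[OF TJ] blQ]] i0 ix
      by (intro integral_cong_AE) auto
    also have "\<dots> = expectation (\<lambda>\<omega>. v0 \<omega> \<bullet> (Q *v v0 \<omega>))
        + expectation (\<lambda>\<omega>. LINT r|lborel. 2 * (Y (r, \<omega>) \<bullet> (Q *v (A *v V (r, \<omega>)))))"
      using i0 ix by simp
    also have "expectation (\<lambda>\<omega>. LINT r|lborel. 2 * (Y (r, \<omega>) \<bullet> (Q *v (A *v V (r, \<omega>))))) =
        (LINT p|LP. 2 * (Y p \<bullet> (Q *v (A *v V p))))"
      using LP.integral_snd[OF i1'] by (simp add: case_prod_beta')
    finally show ?thesis by simp
  qed

  have v0M: "expectation (\<lambda>\<omega>. v0 \<omega> \<bullet> (Q *v M T \<omega>)) = 0"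
  proof -
    have sq: "square_integrable P (\<lambda>\<omega>. Q *v v0 \<omega>)" by (rule square_integrable_linear[OF v0(2) blQ])
    have ms: "(\<lambda>\<omega>. Q *v v0 \<omega>) \<in> borel_measurable (F t0)"
      by (rule borel_measurable_continuous_on[OF linear_continuous_on[OF blQ] v0(1)])
    \<comment> \<open>The integrand does not vanish at the time \<open>t0\<close> itself, but this is a null set.\<close>
    have "expectation (\<lambda>\<omega>. (Q *v v0 \<omega>) \<bullet> I T i \<omega>) = 0" for i
      by (rule expectation_past_inner_ito[OF t0 order_refl I[OF T] _ ms sq])
        (use AE_LP_fst_neq[of t0] in eventually_elim, auto)
    then show ?thesis
      using integrable_inner[OF sq Isq[OF T]]
      by (simp add: inner_matrix_transpose[of "v0 _"] Q M_def inner_sum_right)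
  qed

  \<comment> \<open>\<open>A v\<close> at time \<open>r\<close> is orthogonal to the increment of \<open>M\<close> from \<open>r\<close> to \<open>T\<close>, so \<open>M T\<close> may be replaced
    by \<open>M r = v r - y r\<close>.\<close>
  have drift: "expectation (\<lambda>\<omega>. (A *v v r \<omega>) \<bullet> (Q *v M T \<omega>)) =
      expectation (\<lambda>\<omega>. (A *v v r \<omega>) \<bullet> (Q *v (v r \<omega> - y r \<omega>)))" if r: "r \<in> J" for r
  proof -
    have r': "t0 \<le> r" "r \<le> T" "0 \<le> r" using r t0 by (auto simp: J_def)
    have bl: "bounded_linear (\<lambda>x. Q *v (A *v x))" using bounded_linear_compose[OF blQ blA] .
    have sq: "square_integrable P (\<lambda>\<omega>. Q *v (A *v v r \<omega>))"
      by (rule square_integrable_linear[OF vt[OF r] bl])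
    have ms: "(\<lambda>\<omega>. Q *v (A *v v r \<omega>)) \<in> borel_measurable (F r)"
      by (rule borel_measurable_continuous_on[OF linear_continuous_on[OF bl] vF[OF r'(1)]])
    have zero: "expectation (\<lambda>\<omega>. (Q *v (A *v v r \<omega>)) \<bullet> (I T i \<omega> - I r i \<omega>)) = 0" for i
      by (rule expectation_past_inner_ito[OF t0 r'(1) ito_limit_diff[OF I[OF T] I[OF r'(1)]] _ ms sq])
        (use r' in \<open>auto simp: indicator_def\<close>)
    have "expectation (\<lambda>\<omega>. (Q *v (A *v v r \<omega>)) \<bullet> I T i \<omega>) =
        expectation (\<lambda>\<omega>. (Q *v (A *v v r \<omega>)) \<bullet> I r i \<omega>)" for i
      using zero[of i] Bochner_Integration.integral_diff[OF integrable_inner[OF sq Isq[OF T], of i]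
          integrable_inner[OF sq Isq[OF r'(1)], of i]]
      by (simp add: inner_diff_right)
    then have "expectation (\<lambda>\<omega>. (A *v v r \<omega>) \<bullet> (Q *v M T \<omega>)) =
        expectation (\<lambda>\<omega>. (A *v v r \<omega>) \<bullet> (Q *v M r \<omega>))"
      using integrable_inner[OF sq Isq[OF T]] integrable_inner[OF sq Isq[OF r'(1)]]
      by (simp add: inner_matrix_transpose[of "A *v _"] Q M_def inner_sum_right)
    also have "\<dots> = expectation (\<lambda>\<omega>. (A *v v r \<omega>) \<bullet> (Q *v (v r \<omega> - y r \<omega>)))"
    proof (rule integral_cong_AE)
      show "(\<lambda>\<omega>. (A *v v r \<omega>) \<bullet> (Q *v M r \<omega>)) \<in> borel_measurable P"
        using integrable_inner[OF square_integrable_linear[OF vt[OF r] blA]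
            square_integrable_linear[OF Mt[OF r'(1)] blQ]] by auto
      show "(\<lambda>\<omega>. (A *v v r \<omega>) \<bullet> (Q *v (v r \<omega> - y r \<omega>))) \<in> borel_measurable P"
        using integrable_inner[OF square_integrable_linear[OF vt[OF r] blA]
            square_integrable_linear[OF square_integrable_diff[OF vt[OF r] yr[OF r]] blQ]] by auto
      show "AE \<omega> in P. (A *v v r \<omega>) \<bullet> (Q *v M r \<omega>) = (A *v v r \<omega>) \<bullet> (Q *v (v r \<omega> - y r \<omega>))"
        using vyM[OF r] by eventually_elim simp
    qed
    finally show ?thesis .
  qed

  have DM: "expectation (\<lambda>\<omega>. D T \<omega> \<bullet> (Q *v M T \<omega>)) = (LINT p|LP. (A *v V p) \<bullet> (Q *v (V p - Y p)))"
  proof -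
    let ?f = "\<lambda>r \<omega>. (A *v V (r, \<omega>)) \<bullet> (Q *v M T \<omega>)"
    have JQM: "square_integrable LP (\<lambda>p. indicator J (fst p) *\<^sub>R (Q *v M T (snd p)))"
    proof (rule square_integrable_bound[where h = "\<lambda>p. indicator J (fst p) * (norm (Q *v M T (snd p)))\<^sup>2"])
      have "(\<lambda>p. Q *v M T (snd p)) \<in> borel_measurable LP"
        by (rule measurable_snd_P[OF square_integrable_measurable[OF QM]])
      then show "(\<lambda>p. indicator J (fst p) *\<^sub>R (Q *v M T (snd p))) \<in> borel_measurable LP"
        unfolding J_def by measurable
      show "integrable LP (\<lambda>p. indicator J (fst p) * (norm (Q *v M T (snd p)))\<^sup>2)"
        using square_integrable_norm[OF QM]
        by (intro integrable_LP_interval(1)) (auto simp: J_def emeasure_lborel_Icc_eq)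
    qed (auto simp: indicator_def)
    have "(\<lambda>p. (A *v V p) \<bullet> (indicator J (fst p) *\<^sub>R (Q *v M T (snd p)))) = (\<lambda>(r, \<omega>). ?f r \<omega>)"
      by (auto simp: fun_eq_iff V_def J_def indicator_def)
    with integrable_inner[OF AV JQM] have fi: "integrable LP (\<lambda>(r, \<omega>). ?f r \<omega>)" by simp
    have gi: "integrable LP (\<lambda>(r, \<omega>). (A *v V (r, \<omega>)) \<bullet> (Q *v (V (r, \<omega>) - Y (r, \<omega>))))"
      using integrable_inner[OF AV square_integrable_linear[OF square_integrable_diff[OF V Y] blQ]]
      by (simp add: case_prod_beta')
    have "expectation (\<lambda>\<omega>. D T \<omega> \<bullet> (Q *v M T \<omega>)) = expectation (\<lambda>\<omega>. LINT r|lborel. ?f r \<omega>)"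
    proof (rule integral_cong_AE)
      show "(\<lambda>\<omega>. D T \<omega> \<bullet> (Q *v M T \<omega>)) \<in> borel_measurable P"
        using integrable_inner[OF Dr[OF TJ] QM] by auto
      show "(\<lambda>\<omega>. LINT r|lborel. ?f r \<omega>) \<in> borel_measurable P"
        using LP.integrable_snd[OF fi] by auto
      show "AE \<omega> in P. D T \<omega> \<bullet> (Q *v M T \<omega>) = (LINT r|lborel. ?f r \<omega>)"
        using AVsec
      proof eventually_elim
        case (elim \<omega>)
        have DT: "D T \<omega> = (LINT s|lborel. A *v V (s, \<omega>))"
          unfolding D_def
          by (intro Bochner_Integration.integral_cong) (auto simp: V_def indicator_def)
        have "integrable lborel (\<lambda>s. A *v V (s, \<omega>))"
        proof -
          have "set_integrable lborel {t0..T} (\<lambda>s. A *v V (s, \<omega>))"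
            unfolding set_integrable_def
          proof (rule Bochner_Integration.integrable_bound)
            show "integrable lborel (\<lambda>s. indicator {t0..T} s + (norm (A *v V (s, \<omega>)))\<^sup>2)"
              using elim by (simp add: square_integrable_def emeasure_lborel_Icc_eq)
            show "(\<lambda>s. indicator {t0..T} s *\<^sub>R (A *v V (s, \<omega>))) \<in> borel_measurable lborel"
              by (intro borel_measurable_scaleR borel_measurable_indicator
                  square_integrable_measurable[OF elim]) simp
            have "norm (indicator {t0..T} s *\<^sub>R (A *v V (s, \<omega>))) \<le>
                norm (indicator {t0..T} s + (norm (A *v V (s, \<omega>)))\<^sup>2)" for s
              using abs_inner_le_squares[of "1::real" "norm (A *v V (s, \<omega>))"]
              by (auto simp: indicator_def)
            then show "AE s in lborel. norm (indicator {t0..T} s *\<^sub>R (A *v V (s, \<omega>))) \<le>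
                norm (indicator {t0..T} s + (norm (A *v V (s, \<omega>)))\<^sup>2)" by simp
          qed
          moreover have "(\<lambda>s. indicator {t0..T} s *\<^sub>R (A *v V (s, \<omega>))) = (\<lambda>s. A *v V (s, \<omega>))"
            by (auto simp: V_def indicator_def)
          ultimately show ?thesis by (simp add: set_integrable_def)
        qed
        then show ?case by (simp add: DT integral_inner_left)
      qed
    qed
    also have "\<dots> = (LINT r|lborel. expectation (\<lambda>\<omega>. ?f r \<omega>))"
      by (rule LP.Fubini_integral[OF fi])
    also have "\<dots> = (LINT r|lborel. expectation (\<lambda>\<omega>. (A *v V (r, \<omega>)) \<bullet> (Q *v (V (r, \<omega>) - Y (r, \<omega>)))))"
    proof (rule Bochner_Integration.integral_cong[OF refl])
      fix r
      show "expectation (\<lambda>\<omega>. ?f r \<omega>) =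
          expectation (\<lambda>\<omega>. (A *v V (r, \<omega>)) \<bullet> (Q *v (V (r, \<omega>) - Y (r, \<omega>))))"
        using drift[of r] by (cases "r \<in> J") (auto simp: VJ Y_def V_def J_def)
    qed
    also have "\<dots> = (LINT p|LP. (A *v V p) \<bullet> (Q *v (V p - Y p)))"
      using LP.integral_fst[OF gi] by (simp add: case_prod_beta')
    finally show ?thesis .
  qed

  have "expectation (\<lambda>\<omega>. v T \<omega> \<bullet> (Q *v v T \<omega>)) = expectation (\<lambda>\<omega>. y T \<omega> \<bullet> (Q *v y T \<omega>)
      + 2 * (v0 \<omega> \<bullet> (Q *v M T \<omega>)) + 2 * (D T \<omega> \<bullet> (Q *v M T \<omega>)) + M T \<omega> \<bullet> (Q *v M T \<omega>))"
  proof (rule integral_cong_AE)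
    show "(\<lambda>\<omega>. v T \<omega> \<bullet> (Q *v v T \<omega>)) \<in> borel_measurable P"
      using integrable_inner[OF vt[OF TJ] square_integrable_linear[OF vt[OF TJ] blQ]] by auto
    show "(\<lambda>\<omega>. y T \<omega> \<bullet> (Q *v y T \<omega>) + 2 * (v0 \<omega> \<bullet> (Q *v M T \<omega>)) + 2 * (D T \<omega> \<bullet> (Q *v M T \<omega>))
        + M T \<omega> \<bullet> (Q *v M T \<omega>)) \<in> borel_measurable P"
      using integrable_inner[OF yr[OF TJ] square_integrable_linear[OF yr[OF TJ] blQ]]
        integrable_inner[OF v0(2) QM] integrable_inner[OF Dr[OF TJ] QM] integrable_inner[OF Mt[OF T] QM]
      by auto
    show "AE \<omega> in P. v T \<omega> \<bullet> (Q *v v T \<omega>) = y T \<omega> \<bullet> (Q *v y T \<omega>)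
      + 2 * (v0 \<omega> \<bullet> (Q *v M T \<omega>)) + 2 * (D T \<omega> \<bullet> (Q *v M T \<omega>)) + M T \<omega> \<bullet> (Q *v M T \<omega>)"
      using vyM[OF TJ]
    proof eventually_elim
      case (elim \<omega>)
      then show ?case
        using inner_symmetric_matrix[OF Q, of "M T \<omega>" "y T \<omega>"]
        by (simp add: matrix_vector_right_distrib inner_add_left inner_add_right y_def)
    qed
  qed
  also have "\<dots> = expectation (\<lambda>\<omega>. y T \<omega> \<bullet> (Q *v y T \<omega>)) + 2 * expectation (\<lambda>\<omega>. v0 \<omega> \<bullet> (Q *v M T \<omega>))
      + 2 * expectation (\<lambda>\<omega>. D T \<omega> \<bullet> (Q *v M T \<omega>)) + expectation (\<lambda>\<omega>. M T \<omega> \<bullet> (Q *v M T \<omega>))"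
    using integrable_inner[OF yr[OF TJ] square_integrable_linear[OF yr[OF TJ] blQ]]
      integrable_inner[OF v0(2) QM] integrable_inner[OF Dr[OF TJ] QM] integrable_inner[OF Mt[OF T] QM]
    by simp
  also have "\<dots> = expectation (\<lambda>\<omega>. v0 \<omega> \<bullet> (Q *v v0 \<omega>))
      + (2 * (LINT p|LP. Y p \<bullet> (Q *v (A *v V p))) + 2 * (LINT p|LP. (A *v V p) \<bullet> (Q *v (V p - Y p)))
      + (LINT p|LP. (\<Sum>i\<in>UNIV. \<Sum>j\<in>UNIV. K $ i $ j * ((N i *v V p) \<bullet> (Q *v (N j *v V p))))))"
    unfolding qy v0M DM qM by simp
  also have "2 * (LINT p|LP. Y p \<bullet> (Q *v (A *v V p))) + 2 * (LINT p|LP. (A *v V p) \<bullet> (Q *v (V p - Y p)))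
      + (LINT p|LP. (\<Sum>i\<in>UNIV. \<Sum>j\<in>UNIV. K $ i $ j * ((N i *v V p) \<bullet> (Q *v (N j *v V p))))) =
      (LINT p|LP. 2 * (Y p \<bullet> (Q *v (A *v V p))) + 2 * ((A *v V p) \<bullet> (Q *v (V p - Y p)))
      + (\<Sum>i\<in>UNIV. \<Sum>j\<in>UNIV. K $ i $ j * ((N i *v V p) \<bullet> (Q *v (N j *v V p)))))"
    using integrable_inner[OF Y square_integrable_linear[OF AV blQ]]
      integrable_inner[OF AV square_integrable_linear[OF square_integrable_diff[OF V Y] blQ]]
      integrable_inner[OF NV square_integrable_linear[OF NV blQ]]
    by simp
  also have "\<dots> = (LINT p|LP. V p \<bullet> (lyapunov_op A N K Q *v V p))"
  proof (rule Bochner_Integration.integral_cong[OF refl])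
    fix p
    show "2 * (Y p \<bullet> (Q *v (A *v V p))) + 2 * ((A *v V p) \<bullet> (Q *v (V p - Y p)))
      + (\<Sum>i\<in>UNIV. \<Sum>j\<in>UNIV. K $ i $ j * ((N i *v V p) \<bullet> (Q *v (N j *v V p)))) =
      V p \<bullet> (lyapunov_op A N K Q *v V p)"
      using inner_symmetric_matrix[OF Q, of "A *v V p" "V p - Y p"]
      by (simp add: lyapunov_op_quadratic_form[OF Q] inner_diff_left)
  qed
  finally show "expectation (\<lambda>\<omega>. v T \<omega> \<bullet> (Q *v v T \<omega>)) = expectation (\<lambda>\<omega>. v0 \<omega> \<bullet> (Q *v v0 \<omega>))
      + (LINT p|LP. V p \<bullet> (lyapunov_op A N K Q *v V p))" .
qed

end

section \<open>The energy estimate\<close>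

context wiener_setting
begin

text \<open>The quadratic form identity for \<open>\<eta> z\<close>, with the terminal term dropped.\<close>

lemma weighted_output_energy_le:
  fixes A Q :: "real^'n^'n" and B :: "real^'m^'n" and N :: "'q \<Rightarrow> real^'n^'n" and M :: "'q \<Rightarrow> real^'m^'n"
    and C :: "real^'n^'p" and z :: "real \<Rightarrow> 'w \<Rightarrow> real^'n"
  assumes t0: "0 \<le> t0" and T: "t0 \<le> T"
    and z: "sde_solution P F w A B N M (\<lambda>_ _. 0) t0 x0 z"
    and \<eta>: "\<eta> \<in> borel_measurable (F t0)" and c: "\<And>\<omega>. \<omega> \<in> space P \<Longrightarrow> \<bar>\<eta> \<omega>\<bar> \<le> c"
    and Q: "psd Q" and lyap: "loewner_le (lyapunov_op A N K Q + transpose C ** C) 0"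
  shows "(\<integral>\<^sup>+p. ennreal ((norm (indicator {t0..T} (fst p) *\<^sub>R \<eta> (snd p) *\<^sub>R (C *v z (fst p) (snd p))))\<^sup>2) \<partial>LP)
    \<le> ennreal (x0 \<bullet> (Q *v x0)) * (\<integral>\<^sup>+\<omega>. ennreal ((\<eta> \<omega>)\<^sup>2) \<partial>P)"
proof -
  define v where "v r \<omega> = \<eta> \<omega> *\<^sub>R z r \<omega>" for r \<omega>
  define v0 where "v0 \<omega> = \<eta> \<omega> *\<^sub>R x0" for \<omega>
  define V where "V p = indicator {t0..T} (fst p) *\<^sub>R v (fst p) (snd p)" for p
  have Qs: "transpose Q = Q" and Q0: "\<And>x. 0 \<le> x \<bullet> (Q *v x)" using Q by (auto simp: psd_def)
  have \<eta>P: "\<eta> \<in> borel_measurable P" by (rule measurable_of_F[OF t0 \<eta>])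
  have \<eta>2: "square_integrable P \<eta>" using c by (intro square_integrable_bounded[OF \<eta>P, of c]) auto
  have zL: "L2_adapted P F t0 z" and zc: "AE \<omega> in P. continuous_on {t0..} (\<lambda>t. z t \<omega>)"
    and zI: "\<And>t. t0 \<le> t \<Longrightarrow> \<exists>I. (\<forall>i. has_ito_integral P F (\<lambda>r \<omega>. w r \<omega> $ i) t0 t
             (\<lambda>r \<omega>. N i *v z r \<omega>) (I i)) \<and>
      (AE \<omega> in P. z t \<omega> = x0 + (LINT r:{t0..t}|lborel. A *v z r \<omega>) + (\<Sum>i\<in>UNIV. I i \<omega>))"
    using z by (auto simp: sde_solution_def)
  have vF: "v t \<in> borel_measurable (F t)" if "t0 \<le> t" for t
  proof -
    have "z t \<in> borel_measurable (F t)" using zL that by (simp add: L2_adapted_def adapted_measurable_def)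
    then show ?thesis unfolding v_def by (intro borel_measurable_scaleR measurable_F_mono[OF \<eta> t0 that])
  qed
  have V: "square_integrable LP V"
  proof -
    have "square_integrable LP (\<lambda>p. \<eta> (snd p) *\<^sub>R indicator {t0..T} (fst p) *\<^sub>R z (fst p) (snd p))"
      using c by (intro square_integrable_scaleR_bounded[OF square_integrable_process[OF t0 zL]
          measurable_snd_P[OF \<eta>P], of c]) (auto simp: space_pair_measure)
    then show ?thesis by (simp add: V_def[abs_def] v_def mult.commute)
  qed
  have v0: "v0 \<in> borel_measurable (F t0)" "square_integrable P v0"
  proof -
    show "v0 \<in> borel_measurable (F t0)" unfolding v0_def by (intro borel_measurable_scaleR \<eta>) simp
    show "square_integrable P v0"
      unfolding v0_def by (rule square_integrable_linear[OF \<eta>2 bounded_linear_scaleR_left])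
  qed
  have cont: "AE \<omega> in P. continuous_on {t0..} (\<lambda>t. v t \<omega>)"
    using zc by eventually_elim (simp add: v_def continuous_on_scaleR)
  have eq: "\<exists>I.
      (\<forall>i. ito_limit t0 i (\<lambda>p. indicator {t0..t} (fst p) *\<^sub>R (N i *v v (fst p) (snd p))) (I i)) \<and>
      (AE \<omega> in P. v t \<omega> = v0 \<omega> + (LINT r:{t0..t}|lborel. A *v v r \<omega>) + (\<Sum>i\<in>UNIV. I i \<omega>))"
    if t: "t0 \<le> t" for t
  proof -
    obtain I where I: "\<And>i. has_ito_integral P F (\<lambda>r \<omega>. w r \<omega> $ i) t0 t (\<lambda>r \<omega>. N i *v z r \<omega>) (I i)"
      and zt: "AE \<omega> in P. z t \<omega> = x0 + (LINT r:{t0..t}|lborel. A *v z r \<omega>) + (\<Sum>i\<in>UNIV. I i \<omega>)"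
      using zI[OF t] by blast
    have "ito_limit t0 i (\<lambda>p. indicator {t0..t} (fst p) *\<^sub>R (N i *v v (fst p) (snd p))) (\<lambda>\<omega>. \<eta> \<omega> *\<^sub>R I i \<omega>)" for i
      using ito_limit_scaleR[OF t0 ito_limit_of_has_ito_integral[OF t0 I] \<eta> c, of i]
      by (simp add: v_def matrix_vector_mult_scaleR mult.commute)
    moreover have "AE \<omega> in P. v t \<omega> = v0 \<omega> + (LINT r:{t0..t}|lborel. A *v v r \<omega>) + (\<Sum>i\<in>UNIV. \<eta> \<omega> *\<^sub>R I i \<omega>)"
      using zt
    proof eventually_elim
      case (elim \<omega>)
      have "(LINT r:{t0..t}|lborel. A *v v r \<omega>) = \<eta> \<omega> *\<^sub>R (LINT r:{t0..t}|lborel. A *v z r \<omega>)"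
        by (simp add: v_def matrix_vector_mult_scaleR)
      then show ?case
        using elim by (simp add: v_def v0_def scaleR_sum_right algebra_simps)
    qed
    ultimately show ?thesis by (intro exI[of _ "\<lambda>i \<omega>. \<eta> \<omega> *\<^sub>R I i \<omega>"]) simp
  qed
  note main = expectation_quadratic_form[OF t0 T Qs vF V[unfolded V_def] cont v0 eq, folded V_def]

  have CV: "square_integrable LP (\<lambda>p. C *v V p)"
    by (rule square_integrable_linear[OF V matrix_vector_mul_bounded_linear])
  have LV: "integrable LP (\<lambda>p. V p \<bullet> (lyapunov_op A N K Q *v V p))"
    by (rule integrable_inner[OF V square_integrable_linear[OF V matrix_vector_mul_bounded_linear]])
  have "(norm (C *v x))\<^sup>2 \<le> - (x \<bullet> (lyapunov_op A N K Q *v x))" for x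
  proof -
    have "0 \<le> x \<bullet> ((0 - (lyapunov_op A N K Q + transpose C ** C)) *v x)"
      using lyap by (auto simp: loewner_le_def psd_def)
    also have "\<dots> = - (x \<bullet> (lyapunov_op A N K Q *v x)) - x \<bullet> (transpose C *v (C *v x))"
      by (simp only: matrix_vector_mult_diff_rdistrib matrix_vector_mult_add_rdistrib inner_diff_right
          inner_add_right matrix_vector_mul_assoc) simp
    also have "x \<bullet> (transpose C *v (C *v x)) = (norm (C *v x))\<^sup>2"
      using inner_matrix_transpose[of x "transpose C" "C *v x"] by (simp add: power2_norm_eq_inner)
    finally show ?thesis by simp
  qed
  then have "(LINT p|LP. (norm (C *v V p))\<^sup>2) \<le> (LINT p|LP. - (V p \<bullet> (lyapunov_op A N K Q *v V p)))"
    by (intro integral_mono square_integrable_norm[OF CV] integrable_minus LV)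
  also have "\<dots> = expectation (\<lambda>\<omega>. v0 \<omega> \<bullet> (Q *v v0 \<omega>)) - expectation (\<lambda>\<omega>. v T \<omega> \<bullet> (Q *v v T \<omega>))"
    using main by simp
  also have "\<dots> \<le> expectation (\<lambda>\<omega>. v0 \<omega> \<bullet> (Q *v v0 \<omega>))"
    using Q0 by (simp add: integral_nonneg_AE)
  also have "\<dots> = (x0 \<bullet> (Q *v x0)) * expectation (\<lambda>\<omega>. (\<eta> \<omega>)\<^sup>2)"
  proof -
    have "v0 \<omega> \<bullet> (Q *v v0 \<omega>) = (x0 \<bullet> (Q *v x0)) * (\<eta> \<omega>)\<^sup>2" for \<omega>
      by (simp add: v0_def matrix_vector_mult_scaleR power2_eq_square mult_ac)
    then show ?thesis by simp
  qed
  finally have "ennreal (LINT p|LP. (norm (C *v V p))\<^sup>2) \<le>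
      ennreal (x0 \<bullet> (Q *v x0)) * ennreal (expectation (\<lambda>\<omega>. (\<eta> \<omega>)\<^sup>2))"
    using Q0 by (simp add: ennreal_mult[symmetric] ennreal_leI)
  also have "ennreal (expectation (\<lambda>\<omega>. (\<eta> \<omega>)\<^sup>2)) = (\<integral>\<^sup>+\<omega>. ennreal ((\<eta> \<omega>)\<^sup>2) \<partial>P)"
    using square_integrable_norm[OF \<eta>2] by (intro nn_integral_eq_integral[symmetric]) auto
  also have "ennreal (LINT p|LP. (norm (C *v V p))\<^sup>2) = (\<integral>\<^sup>+p. ennreal ((norm (C *v V p))\<^sup>2) \<partial>LP)"
    by (intro nn_integral_eq_integral[symmetric] square_integrable_norm[OF CV]) simp
  also have "\<dots> =
      (\<integral>\<^sup>+p. ennreal ((norm (indicator {t0..T} (fst p) *\<^sub>R \<eta> (snd p) *\<^sub>R (C *v z (fst p) (snd p))))\<^sup>2) \<partial>LP)"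
    by (simp only: V_def v_def matrix_vector_mult_scaleR)
  finally show ?thesis .
qed

end

theorem proposition3p6:
  fixes P :: "'w measure" and F :: "real \<Rightarrow> 'w measure"
    and w :: "real \<Rightarrow> 'w \<Rightarrow> real^'q" and K :: "real^'q^'q"
    and A :: "real^'n^'n" and B :: "real^'m^'n"
    and N :: "'q \<Rightarrow> real^'n^'n" and M :: "'q \<Rightarrow> real^'m^'n"
    and C :: "real^'n^'p" and D :: "real^'m^'p"
    and u :: "real \<Rightarrow> 'w \<Rightarrow> real^'m"
    and x :: "real \<Rightarrow> 'w \<Rightarrow> real^'n" and y :: "real \<Rightarrow> 'w \<Rightarrow> real^'p"
    and Q :: "real^'n^'n" and q :: "'n \<Rightarrow> real^'n" and \<mu> :: "'n \<Rightarrow> real"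
    and t0 :: real and z :: "real \<Rightarrow> 'w \<Rightarrow> real^'n" and k :: 'n
  assumes "usual_filtered_prob_space P F"
    and "wiener_process P F K w"
    and "mean_square_asymptotically_stable P F w A B N M"
    and "L2_adapted P F 0 u"
    and "sde_solution P F w A B N M u 0 0 x"
    and "\<And>t \<omega>. 0 \<le> t \<Longrightarrow> \<omega> \<in> space P \<Longrightarrow> y t \<omega> = C *v x t \<omega> + D *v u t \<omega>"
    and "psd Q"
    and "loewner_le (lyapunov_op A N K Q + transpose C ** C) 0"
    and "orthonormal_basis q"
    and "\<And>j. Q *v q j = \<mu> j *\<^sub>R q j"
    and "0 \<le> t0"
    and "sde_solution P F w A B N M (\<lambda>_ _. 0) t0 (q k) z"
  shows "(\<integral>\<^sup>+\<omega>. (\<integral>\<^sup>+t\<in>{t0..}. ennreal ((norm ((x t0 \<omega> \<bullet> q k) *\<^sub>R (C *v z t \<omega>)))\<^sup>2) \<partial>lborel) \<partial>P)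
           \<le> ennreal (\<mu> k) * (\<integral>\<^sup>+\<omega>. ennreal ((x t0 \<omega> \<bullet> q k)\<^sup>2) \<partial>P)"
proof -
  interpret wiener_setting P F K w
    using assms(1,2) by (simp add: wiener_setting_def)
  define \<xi> where "\<xi> \<omega> = x t0 \<omega> \<bullet> q k" for \<omega>
  \<comment> \<open>One index \<open>n\<close> governs both the truncation and the horizon, so that one limit suffices.\<close>
  define \<eta> where "\<eta> n \<omega> = (if \<bar>\<xi> \<omega>\<bar> \<le> real n then \<xi> \<omega> else 0)" for n \<omega>
  define g where "g n p = ennreal ((norm (indicator {t0..t0 + real n} (fst p) *\<^sub>R \<eta> n (snd p) *\<^sub>R
      (C *v z (fst p) (snd p))))\<^sup>2)" for n p
  define h where "h p = ennreal ((norm (\<xi> (snd p) *\<^sub>R (C *v z (fst p) (snd p))))\<^sup>2) * indicator {t0..} (fst p)" for p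
  note t0 = assms(11) and z = assms(12)
  have qk: "q k \<bullet> (Q *v q k) = \<mu> k"
    using assms(9,10) by (simp add: orthonormal_basis_def)
  have "x t0 \<in> borel_measurable (F t0)"
    using assms(5) t0 by (simp add: sde_solution_def L2_adapted_def adapted_measurable_def)
  then have \<xi>F: "\<xi> \<in> borel_measurable (F t0)" unfolding \<xi>_def by simp
  then have \<eta>F: "\<eta> n \<in> borel_measurable (F t0)" for n unfolding \<eta>_def by measurable
  have \<xi>P: "\<xi> \<in> borel_measurable P" by (rule measurable_of_F[OF t0 \<xi>F])
  have \<eta>P: "\<eta> n \<in> borel_measurable P" for n by (rule measurable_of_F[OF t0 \<eta>F])
  have zL: "L2_adapted P F t0 z" using z by (simp add: sde_solution_def)
  have Z: "(\<lambda>p. indicator {t0..} (fst p) *\<^sub>R z (fst p) (snd p)) \<in> borel_measurable LP"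
    using zL by (intro adapted_measurable_cutoff[of _ _ t0]) (auto simp: L2_adapted_def)
  have CZ: "(\<lambda>p. C *v (indicator {t0..} (fst p) *\<^sub>R z (fst p) (snd p))) \<in> borel_measurable LP"
    by (rule borel_measurable_continuous_on[OF linear_continuous_on[OF matrix_vector_mul_bounded_linear] Z])
  have g_bound: "(\<integral>\<^sup>+p. g n p \<partial>LP) \<le> ennreal (\<mu> k) * (\<integral>\<^sup>+\<omega>. ennreal ((\<xi> \<omega>)\<^sup>2) \<partial>P)" for n
  proof -
    have "(\<integral>\<^sup>+p. g n p \<partial>LP) \<le> ennreal (q k \<bullet> (Q *v q k)) * (\<integral>\<^sup>+\<omega>. ennreal ((\<eta> n \<omega>)\<^sup>2) \<partial>P)"
      unfolding g_def
      by (rule weighted_output_energy_le[OF t0 _ z \<eta>F _ assms(7,8), where c = "real n"]) (auto simp: \<eta>_def)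
    also have "\<dots> \<le> ennreal (\<mu> k) * (\<integral>\<^sup>+\<omega>. ennreal ((\<xi> \<omega>)\<^sup>2) \<partial>P)"
      unfolding qk by (intro mult_left_mono nn_integral_mono) (auto simp: \<eta>_def)
    finally show ?thesis .
  qed
  \<comment> \<open>For fixed \<open>p\<close> the sequence is eventually constant.\<close>
  have g_lim: "(\<lambda>n. g n p) \<longlonglongrightarrow> h p" for p
  proof -
    obtain n0 :: nat where n0: "\<bar>\<xi> (snd p)\<bar> \<le> real n0" using real_arch_simple by blast
    obtain n1 :: nat where n1: "fst p - t0 \<le> real n1" using real_arch_simple by blast
    have "g n p = h p" if "n \<ge> max n0 n1" for n
    proof -
      have "\<bar>\<xi> (snd p)\<bar> \<le> real n" "fst p \<le> t0 + real n" using n0 n1 that by auto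
      then show ?thesis by (auto simp: g_def h_def \<eta>_def indicator_def)
    qed
    then show ?thesis by (rule tendsto_eventually[OF eventually_mono[OF eventually_ge_at_top]])
  qed
  have gm: "g n \<in> borel_measurable LP" for n
  proof -
    have "g n = (\<lambda>p. ennreal ((norm (indicator {t0..t0 + real n} (fst p) *\<^sub>R \<eta> n (snd p) *\<^sub>R
      (C *v (indicator {t0..} (fst p) *\<^sub>R z (fst p) (snd p)))))\<^sup>2))"
      by (auto simp: g_def fun_eq_iff indicator_def)
    also have "\<dots> \<in> borel_measurable LP" using CZ \<eta>P[of n] by measurable
    finally show ?thesis .
  qed
  have hm: "h \<in> borel_measurable LP"
    by (rule borel_measurable_LIMSEQ_order[OF g_lim gm])
  have "(\<integral>\<^sup>+\<omega>. (\<integral>\<^sup>+t\<in>{t0..}. ennreal ((norm ((x t0 \<omega> \<bullet> q k) *\<^sub>R (C *v z t \<omega>)))\<^sup>2) \<partial>lborel) \<partial>P)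
      = (\<integral>\<^sup>+\<omega>. (\<integral>\<^sup>+t. h (t, \<omega>) \<partial>lborel) \<partial>P)"
    by (simp add: h_def \<xi>_def)
  also have "\<dots> = (\<integral>\<^sup>+p. h p \<partial>LP)" by (rule LP.nn_integral_snd[OF hm])
  also have "\<dots> = (\<integral>\<^sup>+p. liminf (\<lambda>n. g n p) \<partial>LP)"
    by (intro nn_integral_cong lim_imp_Liminf[symmetric] g_lim) simp
  also have "\<dots> \<le> liminf (\<lambda>n. \<integral>\<^sup>+p. g n p \<partial>LP)"
    by (rule nn_integral_liminf[OF gm])
  also have "\<dots> \<le> ennreal (\<mu> k) * (\<integral>\<^sup>+\<omega>. ennreal ((\<xi> \<omega>)\<^sup>2) \<partial>P)"
    using g_bound by (intro Liminf_le always_eventually allI) simp_all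
  finally show ?thesis by (simp add: \<xi>_def)
qed

end
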